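(* Assume $\operatorname{zer}(A+B)\neq\varnothing$. Let $(\gamma_n)$ be a nondecreasing sequence in $\big]0,\frac{\sqrt2-1}{\mu}\big[$ such that $$\tau=\inf_{n\in\mathbb N}\Big(\frac2{\gamma_n}-\frac1{\gamma_{n-1}}-\mu(1+\sqrt2)\Big)>0.$$ Let $(x_n)$ be generated by the reflected stochastic forward–backward iteration with these step sizes, and assume that $$\sum_{n\in\mathbb N}\mathsf E\big[\|r_n-By_n\|^2\mid\mathcal F_n\big]<+\infty\quad\text{a.s.}$$ Then $(x_n)$ converges weakly almost surely to a random variable $\bar x:\Omega\to\operatorname{zer}(A+B)$.
   Context: $\mathcal H$ is a separable real Hilbert space; $(\Omega,\mathcal F,\mathsf P)$ a probability space. $A:\mathcal H\to2^{\mathcal H}$ is maximally monotone; $B:\mathcal H\to\mathcal H$ is monotone and $\mu$-Lipschitz continuous ($\mu>0$); $\operatorname{zer}(A+B)=\{x:0\in Ax+Bx\}$. $J_{\gamma A}=(\mathrm{Id}+\gamma A)^{-1}$. Reflected stochastic forward–backward iteration: $(\gamma_n)_{n\ge-1}$ is a sequence in $]0,+\infty[$, $x_0,x_{-1}$ are square-integrable $\mathcal H$-valued random variables, and for every $n\in\mathbb N$: $y_n=2x_n-x_{n-1}$; $r_n$ is an $\mathcal H$-valued random variable with $\mathsf E[r_n\mid\mathcal F_n]=By_n$, where $\mathcal F_n=\sigma(x_0,\dots,x_n)$; and $x_{n+1}=J_{\gamma_nA}(x_n-\gamma_nr_n)$. *)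

theory Defs
  imports "HOL-Analysis.Analysis" "HOL-Probability.Probability"
begin

definition monotone_op :: "('a::real_inner \<Rightarrow> 'a set) \<Rightarrow> bool" where
  "monotone_op A \<longleftrightarrow> (\<forall>x y u v. u \<in> A x \<longrightarrow> v \<in> A y \<longrightarrow> inner (x - y) (u - v) \<ge> 0)"

definition maximally_monotone :: "('a::real_inner \<Rightarrow> 'a set) \<Rightarrow> bool" where
  "maximally_monotone A \<longleftrightarrow> monotone_op A \<and>
     (\<forall>A'. monotone_op A' \<and> (\<forall>x. A x \<subseteq> A' x) \<longrightarrow> A' = A)"

definition monotone_fun :: "('a::real_inner \<Rightarrow> 'a) \<Rightarrow> bool" where
  "monotone_fun B \<longleftrightarrow> (\<forall>x y. inner (x - y) (B x - B y) \<ge> 0)"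

definition resolvent :: "real \<Rightarrow> ('a::real_inner \<Rightarrow> 'a set) \<Rightarrow> 'a \<Rightarrow> 'a" where
  "resolvent \<gamma> A x = (THE p. \<exists>u \<in> A p. x = p + \<gamma> *\<^sub>R u)"

definition zer_sum :: "('a::real_inner \<Rightarrow> 'a set) \<Rightarrow> ('a \<Rightarrow> 'a) \<Rightarrow> 'a set" where
  "zer_sum A B = {x. \<exists>u \<in> A x. u + B x = 0}"

definition nat_filtration :: "'w measure \<Rightarrow> (nat \<Rightarrow> 'w \<Rightarrow> 'a::topological_space) \<Rightarrow> nat \<Rightarrow> 'w measure" where
  "nat_filtration M x n =
     sigma (space M) (\<Union>i\<in>{..n}. {x i -` S \<inter> space M | S. S \<in> sets borel})"

definition is_cond_exp :: "'w measure \<Rightarrow> 'w measure \<Rightarrow> ('w \<Rightarrow> 'a::{banach, second_countable_topology})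
     \<Rightarrow> ('w \<Rightarrow> 'a) \<Rightarrow> bool" where
  "is_cond_exp M F f g \<longleftrightarrow>
     integrable M f \<and> g \<in> borel_measurable F \<and> integrable M g \<and>
     (\<forall>S \<in> sets F. (LINT w:S|M. f w) = (LINT w:S|M. g w))"

end

theory Submission
  imports Defs "HOL-Complex_Analysis.Great_Picard"
begin

text \<open>For a zero \<open>a\<close> and the increments \<open>d\<^sub>n = x\<^sub>n - x\<^sub>n\<^sub>-\<^sub>1\<close>, monotonicity of \<open>A\<close>
  between the new iterate and \<open>a\<close>, and between two consecutive iterates, shows that the quantity
  \<open>\<parallel>x\<^sub>n\<^sub>+\<^sub>1 - a\<parallel>\<^sup>2 / \<gamma>\<^sub>n + 2 \<langle>B y\<^sub>n - B a, d\<^sub>n\<^sub>+\<^sub>1\<rangle> + (1 / \<gamma>\<^sub>n + \<mu> (1 + sqrt 2)) \<parallel>d\<^sub>n\<^sub>+\<^sub>1\<parallel>\<^sup>2 + \<mu> \<parallel>d\<^sub>n\<^sub>+\<^sub>1 - d\<^sub>n\<parallel>\<^sup>2\<close>,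
  which dominates \<open>\<mu> \<parallel>x\<^sub>n\<^sub>+\<^sub>1 - a\<parallel>\<^sup>2\<close>, decreases by a multiple of \<open>\<parallel>d\<^sub>n\<^sub>+\<^sub>1\<parallel>\<^sup>2\<close> up to the squared
  errors and a martingale difference.  Restricted to the events on which the summed conditional variances
  stay below a constant, it is a nonnegative quasi-supermartingale, which converges by the upcrossing
  inequality.  Hence almost surely \<open>\<parallel>x\<^sub>n - a\<parallel>\<close> converges for all \<open>a\<close> in a countable dense
  set of zeros and \<open>d\<^sub>n\<close> tends to 0, so that weak cluster points are zeros, and Opial's argument applies.\<close>

section \<open>Minimisation, Riesz representation and Minty's theorem\<close>

text \<open>The noise is summable only almost surely and after conditioning, so neither errors nor
  iterates need be square-integrable and there is no supermartingale on the whole space. What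
  rescues the argument: the conditional variances up to index n are \<open>F n\<close>-measurable
  although the n-th error is not, so the event that their sum stays below c is known before that
  error is drawn and makes it square-integrable. These events decrease in n, and over natural c they
  cover almost every path. The number s = 1 + sqrt 2 is the positive root of s = 2 + 1/s. Young's
  inequality with weights s and 1/s leaves 2 + 1/s in front of the squared second difference, and
  the bound on the step sizes must absorb this, while s itself stands before the squared increment.
  The new iterate depends on the current error, so only the pairing of that error with the previous
  iterate is a martingale difference; the rest is paid for by half of \<tau>. Maximality of A + B is
  never established. A contraction argument supplies the one consequence needed to identify weak
  cluster points. Minty's theorem enters because the resolvent is a definite description and is
  meaningless without existence.\<close>

text \<open>The parallelogram law makes a minimising sequence Cauchy, so completeness replaces weak
  compactness, which itself will rest on Riesz. With \<open>E\<close> an epigraph this minimises a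
  convex function plus half the squared norm; Riesz and Minty are two instances.\<close>

lemma quadratic_min_exists:
  fixes E :: "('b::{real_inner, complete_space} \<times> real) set"
  assumes "closed E" "convex E" "E \<noteq> {}"
    and bdd: "bdd_below ((\<lambda>(p, t). t + (norm p)\<^sup>2 / 2) ` E)"
  obtains p t where "(p, t) \<in> E"
    "\<And>q s. (q, s) \<in> E \<Longrightarrow> t + (norm p)\<^sup>2 / 2 \<le> s + (norm q)\<^sup>2 / 2"
proof -
  define f where "f = (\<lambda>(p::'b, t::real). t + (norm p)\<^sup>2 / 2)"
  define m where "m = Inf (f ` E)"
  have m_le: "m \<le> f z" if "z \<in> E" for z
    unfolding m_def using bdd that by (auto simp: f_def intro: cInf_lower)
  have "\<exists>z\<in>E. f z < m + 1 / real (Suc n)" for n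
    using cInf_lessD[of "f ` E" "m + 1 / real (Suc n)"] \<open>E \<noteq> {}\<close> by (auto simp: m_def)
  then obtain z where zE: "\<And>n. z n \<in> E" and z: "\<And>n. f (z n) < m + 1 / real (Suc n)"
    by metis
  have fz: "(\<lambda>n. f (z n)) \<longlonglongrightarrow> m"
  proof (rule tendsto_sandwich[of "\<lambda>_. m" _ _ "\<lambda>n. m + 1 / real (Suc n)"])
    show "\<forall>\<^sub>F n in sequentially. m \<le> f (z n)" using m_le[OF zE] by (intro always_eventually) blast
    show "\<forall>\<^sub>F n in sequentially. f (z n) \<le> m + 1 / real (Suc n)"
      by (intro always_eventually allI less_imp_le z)
    show "(\<lambda>n. m + 1 / real (Suc n)) \<longlonglongrightarrow> m"
      using tendsto_add[OF tendsto_const LIMSEQ_inverse_real_of_nat, of m] by (simp add: inverse_eq_divide)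
  qed simp
  \<comment> \<open>At the midpoint \<open>f\<close> equals the mean of its two values minus one
    eighth of the squared distance of the first components, and it is still at least
    \<open>m\<close>.\<close>
  have mid: "(norm (fst z1 - fst z2))\<^sup>2 \<le> 4 * (f z1 - m) + 4 * (f z2 - m)"
    if "z1 \<in> E" "z2 \<in> E" for z1 z2
  proof -
    have "(1/2) *\<^sub>R z1 + (1/2) *\<^sub>R z2 \<in> E"
      using \<open>convex E\<close> that by (auto intro: convexD)
    from m_le[OF this] show ?thesis
      by (cases z1; cases z2)
         (simp add: f_def power2_norm_eq_inner inner_simps inner_commute field_simps)
  qed
  have "Cauchy (\<lambda>n. fst (z n))"
  proof (rule metric_CauchyI)
    fix e :: real assume "e > 0"
    have "(\<lambda>n. 4 * (f (z n) - m)) \<longlonglongrightarrow> 4 * (m - m)"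
      by (intro tendsto_intros fz)
    then have "\<forall>\<^sub>F n in sequentially. 4 * (f (z n) - m) < e\<^sup>2 / 2"
      by (rule order_tendstoD) (use \<open>e > 0\<close> in simp)
    then obtain N where N: "\<And>n. n \<ge> N \<Longrightarrow> 4 * (f (z n) - m) < e\<^sup>2 / 2"
      by (auto simp: eventually_sequentially)
    have "dist (fst (z k)) (fst (z n)) < e" if "k \<ge> N" "n \<ge> N" for k n
    proof -
      have "(norm (fst (z k) - fst (z n)))\<^sup>2 < e\<^sup>2"
        using mid[OF zE zE, of k n] N[OF that(1)] N[OF that(2)] by linarith
      then show ?thesis using \<open>e > 0\<close> by (simp add: dist_norm power2_less_imp_less)
    qed
    then show "\<exists>M. \<forall>m\<ge>M. \<forall>n\<ge>M. dist (fst (z m)) (fst (z n)) < e" by blast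
  qed
  then obtain p where p: "(\<lambda>n. fst (z n)) \<longlonglongrightarrow> p"
    using Cauchy_convergent_iff convergent_def by blast
  \<comment> \<open>Only the first components are known to be Cauchy; the second ones converge
    because the values of \<open>f\<close> do.\<close>
  have sndz: "snd (z n) = f (z n) - (norm (fst (z n)))\<^sup>2 / 2" for n
    by (simp add: f_def case_prod_beta)
  have "(\<lambda>n. snd (z n)) \<longlonglongrightarrow> m - (norm p)\<^sup>2 / 2"
    unfolding sndz by (intro tendsto_intros fz p) auto
  with p have "(\<lambda>n. (fst (z n), snd (z n))) \<longlonglongrightarrow> (p, m - (norm p)\<^sup>2 / 2)"
    by (rule tendsto_Pair)
  then have "(p, m - (norm p)\<^sup>2 / 2) \<in> E"
    using \<open>closed E\<close> zE unfolding closed_sequential_limits by auto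
  with m_le that show ?thesis by (fastforce simp: f_def)
qed

text \<open>The representing vector is the minimiser of |v|^2/2 - L v; the first-order condition
  along v and -v gives the equality.\<close>

lemma riesz_representation:
  fixes L :: "'a::{real_inner, complete_space} \<Rightarrow> real"
  assumes "bounded_linear L"
  obtains p where "\<And>v. L v = inner p v"
proof -
  interpret L: bounded_linear L by fact
  obtain K where K: "\<And>v. norm (L v) \<le> norm v * K" using L.bounded by blast
  let ?E = "{(v, t). - L v \<le> t}"
  have "closed ?E"
    unfolding case_prod_beta by (intro closed_Collect_le continuous_intros L.continuous_on)
  moreover have "convex ?E"
  proof (rule convexI)
    fix z z' and a b :: real
    assume "z \<in> ?E" "z' \<in> ?E" "0 \<le> a" "0 \<le> b"
    then show "a *\<^sub>R z + b *\<^sub>R z' \<in> ?E"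
      using mult_left_mono[of "- L (fst z)" "snd z" a] mult_left_mono[of "- L (fst z')" "snd z'" b]
      by (auto simp: case_prod_beta L.add L.scale)
  qed
  moreover have "?E \<noteq> {}" by auto
  moreover have "bdd_below ((\<lambda>(p, t). t + (norm p)\<^sup>2 / 2) ` ?E)"
  \<comment> \<open>From L v \<le> K |v| and 2 K |v| \<le> K^2 + |v|^2.\<close>
  proof (rule bdd_belowI2[of _ "- (K\<^sup>2 / 2)"])
    fix z assume "z \<in> ?E"
    moreover have "0 \<le> (norm (fst z) - K)\<^sup>2" by simp
    ultimately show "- (K\<^sup>2 / 2) \<le> (case z of (p, t) \<Rightarrow> t + (norm p)\<^sup>2 / 2)"
      using K[of "fst z"] by (auto simp: power2_eq_square algebra_simps)
  qed
  ultimately obtain p t where pt: "(p, t) \<in> ?E"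
    and min: "\<And>q s. (q, s) \<in> ?E \<Longrightarrow> t + (norm p)\<^sup>2 / 2 \<le> s + (norm q)\<^sup>2 / 2"
    by (metis quadratic_min_exists)
  have ge: "L v \<le> inner p v" for v
  proof (rule field_le_epsilon)
    fix e :: real assume "e > 0"
    \<comment> \<open>A step along v small enough that the quadratic remainder s |v|^2 / 2 is at
      most e; the added 1 covers v = 0.\<close>
    define s where "s = e / ((norm v)\<^sup>2 + 1)"
    have "s > 0" using \<open>e > 0\<close> by (simp add: s_def add_nonneg_pos)
    have "s * (norm v)\<^sup>2 / 2 \<le> e"
    proof -
      have "e * (norm v)\<^sup>2 \<le> e * (2 * ((norm v)\<^sup>2 + 1))"
        by (rule mult_left_mono) (use \<open>e > 0\<close> in auto)
      moreover have "(norm v)\<^sup>2 + 1 > 0" by (simp add: add_nonneg_pos)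
      ultimately show ?thesis
        by (simp add: s_def pos_divide_le_eq mult.commute mult.left_commute)
    qed
    moreover have "- L p + (norm p)\<^sup>2 / 2 \<le> - L (p + s *\<^sub>R v) + (norm (p + s *\<^sub>R v))\<^sup>2 / 2"
      using min[of "p + s *\<^sub>R v" "- L (p + s *\<^sub>R v)"] pt by simp
    then have "s * L v \<le> s * (inner p v + s * (norm v)\<^sup>2 / 2)"
      by (simp add: L.add L.scale power2_norm_eq_inner inner_simps inner_commute algebra_simps)
    then have "L v \<le> inner p v + s * (norm v)\<^sup>2 / 2"
      using \<open>s > 0\<close> by simp
    ultimately show "L v \<le> inner p v + e" by simp
  qed
  have "L v = inner p v" for v
    using ge[of v] ge[of "- v"] by (simp add: L.neg)
  then show ?thesis by (rule that)
qed

text \<open>Minty's theorem by minimising the Fitzpatrick function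
  \<open>sup {\<langle>x,b\<rangle> + \<langle>a,v\<rangle> - \<langle>a,b\<rangle> | (a,b) \<in> G}\<close> of the graph plus half the squared norm
  (Simons and Zalinescu).\<close>

lemma minty_graph:
  fixes G :: "('a::{real_inner, complete_space} \<times> 'a) set"
  assumes mono: "\<And>a b c d. (a, b) \<in> G \<Longrightarrow> (c, d) \<in> G \<Longrightarrow> inner (a - c) (b - d) \<ge> 0"
    and max: "\<And>x u. (\<And>a b. (a, b) \<in> G \<Longrightarrow> inner (x - a) (u - b) \<ge> 0) \<Longrightarrow> (x, u) \<in> G"
  shows "\<exists>x. (x, - x) \<in> G"
proof -
  let ?g = "\<lambda>z a b. inner (fst (fst z)) b + inner a (snd (fst z)) - inner a b"
  define E where "E = {z :: ('a \<times> 'a) \<times> real. \<forall>(a, b)\<in>G. ?g z a b \<le> snd z}"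
  have E_eq: "E = (\<Inter>(a, b)\<in>G. {z. ?g z a b \<le> snd z})"
    by (auto simp: E_def)
  have "closed E"
    unfolding E_eq by (auto intro!: closed_INT closed_Collect_le continuous_intros)
  moreover have "convex E"
  proof -
    have "convex {z. ?g z a b \<le> snd z}" for a b :: 'a
    proof -
      have "{z. ?g z a b \<le> snd z} = {z. inner ((b, a), -1) z \<le> inner a b}"
        by (auto simp: inner_prod_def inner_commute algebra_simps)
      then show ?thesis by (simp only: convex_halfspace_le)
    qed
    then show ?thesis unfolding E_eq by (auto intro!: convex_INT)
  qed
  \<comment> \<open>By monotonicity the Fitzpatrick function is at most the inner product on the
    graph; \<open>fitz\<close> is the opposite bound everywhere, which uses maximality.\<close>
  moreover have graph: "((a, b), inner a b) \<in> E" if "(a, b) \<in> G" for a b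
    using mono[OF that] by (auto simp: E_def inner_simps inner_commute) (smt (verit) inner_commute)
  moreover have "G \<noteq> {}" using max[of 0 0] by auto
  then have "E \<noteq> {}" using graph by auto
  moreover have fitz: "inner p q \<le> t" if "((p, q), t) \<in> E" for p q t
  proof (cases "(p, q) \<in> G")
    case True
    then show ?thesis using that by (auto simp: E_def)
  next
    case False
    then obtain a b where "(a, b) \<in> G" "inner (p - a) (q - b) < 0"
      using max[of p q] by force
    then show ?thesis using that by (fastforce simp: E_def inner_simps)
  qed
  have "bdd_below ((\<lambda>(p, t). t + (norm p)\<^sup>2 / 2) ` E)"
  proof (rule bdd_belowI2[of _ 0])
    fix z assume "z \<in> E"
    obtain p q t where z: "z = ((p, q), t)" by (metis prod.exhaust)
    have "0 \<le> inner (p + q) (p + q)" by simp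
    with fitz[of p q t] \<open>z \<in> E\<close> show "0 \<le> (case z of (p, t) \<Rightarrow> t + (norm p)\<^sup>2 / 2)"
      by (simp add: z power2_norm_eq_inner inner_simps inner_commute field_simps)
  qed
  ultimately obtain pp t where "(pp, t) \<in> E"
    and min': "\<And>q s. (q, s) \<in> E \<Longrightarrow> t + (norm pp)\<^sup>2 / 2 \<le> s + (norm q)\<^sup>2 / 2"
    by (metis quadratic_min_exists)
  then obtain p q where E: "((p, q), t) \<in> E"
    and min: "\<And>a b s. ((a, b), s) \<in> E \<Longrightarrow>
      t + ((norm p)\<^sup>2 + (norm q)\<^sup>2) / 2 \<le> s + ((norm a)\<^sup>2 + (norm b)\<^sup>2) / 2"
    by (cases pp) (force simp: power2_norm_eq_inner)
  \<comment> \<open>The first-order condition of the minimum, tested against the points of the graph.\<close>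
  have opt: "inner p q + (norm p)\<^sup>2 + (norm q)\<^sup>2 \<le> inner a b + inner p a + inner q b"
    if "(a, b) \<in> G" for a b
  proof -
    have line: "t \<le> inner a b + (inner p (a - p) + inner q (b - q)) + s * ((norm (a - p))\<^sup>2 + (norm (b - q))\<^sup>2) / 2"
      if "s > 0" "s \<le> 1" for s
    proof -
      have "(1 - s) *\<^sub>R ((p, q), t) + s *\<^sub>R ((a, b), inner a b) \<in> E"
        using \<open>convex E\<close> E graph[OF \<open>(a, b) \<in> G\<close>] that by (intro convexD) auto
      then have *: "((p + s *\<^sub>R (a - p), q + s *\<^sub>R (b - q)), t + s * (inner a b - t)) \<in> E"
        by (simp add: algebra_simps)
      have "s * t \<le> s * (inner a b + (inner p (a - p) + inner q (b - q)) + s * ((norm (a - p))\<^sup>2 + (norm (b - q))\<^sup>2) / 2)"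
      proof -
        have n: "(norm (u + s *\<^sub>R v))\<^sup>2 = (norm u)\<^sup>2 + 2 * s * inner u v + s * s * (norm v)\<^sup>2" for u v :: 'a
          by (simp add: power2_norm_eq_inner inner_simps inner_commute algebra_simps)
        show ?thesis using min[OF *] unfolding n by (simp add: field_simps)
      qed
      then show ?thesis using that by simp
    qed
    have lim: "((\<lambda>s. inner a b + (inner p (a - p) + inner q (b - q)) + s * ((norm (a - p))\<^sup>2 + (norm (b - q))\<^sup>2) / 2)
       \<longlongrightarrow> inner a b + (inner p (a - p) + inner q (b - q)) + 0 * ((norm (a - p))\<^sup>2 + (norm (b - q))\<^sup>2) / 2) (at_right 0)"
      by (intro tendsto_intros) auto
    have "t \<le> inner a b + (inner p (a - p) + inner q (b - q)) + 0 * ((norm (a - p))\<^sup>2 + (norm (b - q))\<^sup>2) / 2"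
    proof (rule tendsto_lowerbound[OF lim])
      show "\<forall>\<^sub>F s in at_right 0. t \<le> inner a b + (inner p (a - p) + inner q (b - q)) + s * ((norm (a - p))\<^sup>2 + (norm (b - q))\<^sup>2) / 2"
        unfolding eventually_at_right_field using line by (intro exI[of _ 1]) auto
    qed simp
    with fitz[OF E] show ?thesis
      by (simp add: inner_simps power2_norm_eq_inner)
  qed
  have sq: "(norm p)\<^sup>2 + (norm q)\<^sup>2 + 2 * inner p q = (norm (p + q))\<^sup>2"
    by (simp add: power2_norm_eq_inner inner_simps inner_commute)
  \<comment> \<open>Since the left side is nonnegative, maximality puts (-q, -p) into
    \<open>G\<close>. Testing the inequality at that very point makes the right side vanish, hence q
    = -p.\<close>
  have key: "(norm (p + q))\<^sup>2 \<le> inner (- q - a) (- p - b)" if "(a, b) \<in> G" for a b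
    using opt[OF that] sq by (simp add: inner_simps inner_commute)
  then have mem: "(- q, - p) \<in> G"
    by (intro max) (meson order_trans zero_le_power2)
  from key[OF this] have "p + q = 0" by simp
  then have "q = - p" by (simp add: eq_neg_iff_add_eq_0 add.commute)
  with mem show ?thesis by auto
qed

section \<open>Resolvents, zeros and weak convergence\<close>

lemma monotone_opD:
  "monotone_op A \<Longrightarrow> u \<in> A x \<Longrightarrow> v \<in> A y \<Longrightarrow> inner (x - y) (u - v) \<ge> 0"
  by (auto simp: monotone_op_def)

text \<open>Adding the single pair (x, u) to the graph keeps it monotone, so by maximality the pair
  was already there.\<close>

lemma maximally_monotoneD:
  assumes "maximally_monotone A" "\<And>y v. v \<in> A y \<Longrightarrow> inner (x - y) (u - v) \<ge> 0"
  shows "u \<in> A x"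
proof -
  define A' where "A' = (\<lambda>y. if y = x then insert u (A x) else A y)"
  have "monotone_op A"
    using assms(1) by (simp add: maximally_monotone_def)
  moreover have "inner (y - x) (v - u) \<ge> 0" if "v \<in> A y" for y v
    using assms(2)[OF that] by (simp add: inner_simps)
  ultimately have "monotone_op A'"
    using assms(2) unfolding monotone_op_def A'_def by auto
  moreover have "\<forall>x. A x \<subseteq> A' x"
    by (auto simp: A'_def)
  ultimately have "A' = A"
    using assms(1) by (simp add: maximally_monotone_def)
  then show ?thesis
    by (metis A'_def insertI1)
qed

lemma minty:
  fixes A :: "'a::{real_inner, complete_space} \<Rightarrow> 'a set"
  assumes A: "maximally_monotone A" and "\<gamma> > 0"
  obtains p u where "u \<in> A p" "z = p + \<gamma> *\<^sub>R u"
proof -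
  \<comment> \<open>Scaling by \<gamma> and shifting by -z turns z = p + \<gamma> u into membership
    of (p, -p).\<close>
  let ?G = "{(p, \<gamma> *\<^sub>R u - z) | p u. u \<in> A p}"
  have mono: "monotone_op A" using A by (simp add: maximally_monotone_def)
  have "\<exists>x. (x, - x) \<in> ?G"
  proof (rule minty_graph)
    fix a b c d assume "(a, b) \<in> ?G" "(c, d) \<in> ?G"
    then show "inner (a - c) (b - d) \<ge> 0"
      using monotone_opD[OF mono] \<open>\<gamma> > 0\<close>
      by (auto simp flip: scaleR_diff_right)
  next
    fix x v assume *: "\<And>a b. (a, b) \<in> ?G \<Longrightarrow> inner (x - a) (v - b) \<ge> 0"
    have "(1 / \<gamma>) *\<^sub>R (v + z) \<in> A x"
    proof (rule maximally_monotoneD[OF A])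
      fix a u assume "u \<in> A a"
      then have "0 \<le> inner (x - a) (v - (\<gamma> *\<^sub>R u - z))" by (intro *) auto
      also have "v - (\<gamma> *\<^sub>R u - z) = \<gamma> *\<^sub>R ((1 / \<gamma>) *\<^sub>R (v + z) - u)"
        using \<open>\<gamma> > 0\<close> by (simp add: algebra_simps)
      finally show "0 \<le> inner (x - a) ((1 / \<gamma>) *\<^sub>R (v + z) - u)"
        using \<open>\<gamma> > 0\<close> by (simp add: zero_le_mult_iff)
    qed
    then show "(x, v) \<in> ?G"
      using \<open>\<gamma> > 0\<close> by (auto intro!: exI[of _ "(1 / \<gamma>) *\<^sub>R (v + z)"])
  qed
  then obtain p u where "u \<in> A p" "- p = \<gamma> *\<^sub>R u - z" by auto
  then show ?thesis
    by (intro that[of u p]) (auto simp: algebra_simps)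
qed

text \<open>Stated for points of the graph, so that it gives uniqueness in the definition of the
  resolvent before that is well defined, and later compares an iterate with a zero.\<close>

lemma monotone_op_nonexpansive:
  assumes "monotone_op A" "\<gamma> > 0" "u \<in> A p" "v \<in> A q"
  shows "norm (p - q) \<le> norm ((p + \<gamma> *\<^sub>R u) - (q + \<gamma> *\<^sub>R v))"
proof -
  have "0 \<le> \<gamma> * inner (p - q) (u - v)"
    using monotone_opD[OF assms(1,3,4)] \<open>\<gamma> > 0\<close> by simp
  then have "(norm (p - q))\<^sup>2 \<le> inner (p - q) ((p + \<gamma> *\<^sub>R u) - (q + \<gamma> *\<^sub>R v))"
    by (simp add: power2_norm_eq_inner inner_simps algebra_simps)
  also have "\<dots> \<le> norm (p - q) * norm ((p + \<gamma> *\<^sub>R u) - (q + \<gamma> *\<^sub>R v))"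
    by (rule norm_cauchy_schwarz)
  finally show ?thesis
    by (cases "p = q") (auto simp: power2_eq_square)
qed

lemma resolvent_eqI:
  assumes "monotone_op A" "\<gamma> > 0" "u \<in> A p" "z = p + \<gamma> *\<^sub>R u"
  shows "resolvent \<gamma> A z = p"
  unfolding resolvent_def
proof (rule the_equality)
  fix q assume "\<exists>v\<in>A q. z = q + \<gamma> *\<^sub>R v"
  then obtain v where "v \<in> A q" "z = q + \<gamma> *\<^sub>R v" by blast
  then have "norm (q - p) \<le> norm (z - z)"
    using monotone_op_nonexpansive[OF assms(1,2) _ assms(3)] assms(4) by metis
  then show "q = p" by simp
qed (use assms in blast)

lemma resolvent_mem:
  fixes A :: "'a::{real_inner, complete_space} \<Rightarrow> 'a set"
  assumes A: "maximally_monotone A" and "\<gamma> > 0"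
  shows "(1 / \<gamma>) *\<^sub>R (z - resolvent \<gamma> A z) \<in> A (resolvent \<gamma> A z)"
proof -
  obtain p u where pu: "u \<in> A p" "z = p + \<gamma> *\<^sub>R u"
    using minty[OF assms] by metis
  then have "resolvent \<gamma> A z = p"
    using resolvent_eqI A \<open>\<gamma> > 0\<close> by (metis maximally_monotone_def)
  with pu show ?thesis using \<open>\<gamma> > 0\<close> by simp
qed

lemma resolvent_nonexpansive:
  fixes A :: "'a::{real_inner, complete_space} \<Rightarrow> 'a set"
  assumes A: "maximally_monotone A" and "\<gamma> > 0"
  shows "dist (resolvent \<gamma> A z) (resolvent \<gamma> A z') \<le> dist z z'"
  using monotone_op_nonexpansive[where u = "(1 / \<gamma>) *\<^sub>R (z - resolvent \<gamma> A z)"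
      and v = "(1 / \<gamma>) *\<^sub>R (z' - resolvent \<gamma> A z')" and \<gamma> = \<gamma> and A = A and p = "resolvent \<gamma> A z" and q = "resolvent \<gamma> A z'"]
    resolvent_mem[OF assms] A \<open>\<gamma> > 0\<close> by (simp add: maximally_monotone_def dist_norm)

lemma continuous_on_resolvent:
  fixes A :: "'a::{real_inner, complete_space} \<Rightarrow> 'a set"
  assumes "maximally_monotone A" and "\<gamma> > 0"
  shows "continuous_on UNIV (resolvent \<gamma> A)"
  using resolvent_nonexpansive[OF assms]
  by (intro continuous_on_iff[THEN iffD2]) (metis le_less_trans)

text \<open>The point \<open>x\<close> is compared with the fixed point of the contraction
  \<open>z \<mapsto> J\<^bsub>\<lambda>A\<^esub> (x - \<lambda> B z)\<close>.\<close>

lemma zer_sum_maximality: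
  fixes A :: "'a::{real_inner, complete_space} \<Rightarrow> 'a set"
  assumes A: "maximally_monotone A" and "\<mu> > 0" and B: "\<mu>-lipschitz_on UNIV B"
    and rel: "\<And>z w. w \<in> A z \<Longrightarrow> inner (x - z) (- B z - w) \<ge> 0"
  shows "x \<in> zer_sum A B"
proof -
  \<comment> \<open>This step makes the map a contraction with factor l \<mu> = 1/2.\<close>
  define l where "l = 1 / (2 * \<mu>)"
  have "l > 0" using \<open>\<mu> > 0\<close> by (simp add: l_def)
  define T where "T z = resolvent l A (x - l *\<^sub>R B z)" for z
  have "\<exists>!z. z \<in> UNIV \<and> T z = z"
  proof (rule Banach_fix[of _ "1/2"])
    show "dist (T z) (T z') \<le> 1 / 2 * dist z z'" for z z'
    proof -
      have "dist (T z) (T z') \<le> dist (x - l *\<^sub>R B z) (x - l *\<^sub>R B z')"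
        unfolding T_def by (rule resolvent_nonexpansive[OF A \<open>l > 0\<close>])
      also have "\<dots> = l * dist (B z) (B z')"
        using \<open>l > 0\<close> by (simp add: dist_norm norm_minus_commute flip: scaleR_diff_right)
      also have "\<dots> \<le> l * (\<mu> * dist z z')"
        using \<open>l > 0\<close> lipschitz_onD[OF B] by (intro mult_left_mono) auto
      finally show ?thesis using \<open>\<mu> > 0\<close> by (simp add: l_def)
    qed
  qed (auto simp: complete_UNIV)
  then obtain z where z: "T z = z" by auto
  define w where "w = (1 / l) *\<^sub>R (x - l *\<^sub>R B z - z)"
  have w: "w \<in> A z"
    using resolvent_mem[OF A \<open>l > 0\<close>, of "x - l *\<^sub>R B z"] z by (simp add: T_def w_def)
  \<comment> \<open>The fixed point satisfies w + B z = (x - z) / l, so \<open>rel\<close> at (z, w)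
    bounds -|x - z|^2 / l below by 0.\<close>
  have "- B z - w = - ((1 / l) *\<^sub>R (x - z))"
    using \<open>l > 0\<close> by (simp add: w_def algebra_simps)
  then have "0 \<le> - ((1 / l) * (norm (x - z))\<^sup>2)"
    using rel[OF w] by (simp add: power2_norm_eq_inner)
  then have "x = z"
    using \<open>l > 0\<close> by (simp add: mult_le_0_iff divide_le_0_iff)
  with w have "- B x \<in> A x" using \<open>l > 0\<close> by (simp add: w_def)
  then show ?thesis by (auto simp: zer_sum_def intro!: bexI[of _ "- B x"])
qed

section \<open>Weak sequential compactness, Opial's lemma and weak cluster points\<close>

lemma bounded_weak_limit:
  fixes x :: "nat \<Rightarrow> 'a::{real_inner, complete_space}"
  assumes "\<And>n. norm (x n) \<le> C" and conv: "\<And>v. convergent (\<lambda>n. inner (x n) v)"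
  obtains l where "\<And>v. (\<lambda>n. inner (x n) v) \<longlonglongrightarrow> inner l v"
proof -
  define L where "L v = lim (\<lambda>n. inner (x n) v)" for v
  have L: "(\<lambda>n. inner (x n) v) \<longlonglongrightarrow> L v" for v
    using conv by (simp add: L_def convergent_LIMSEQ_iff)
  have "bounded_linear L"
  proof (rule bounded_linear_intro[of _ C])
    show "L (v + w) = L v + L w" for v w
      by (rule LIMSEQ_unique[OF L]) (auto simp: inner_simps intro: tendsto_add L)
    show "L (c *\<^sub>R v) = c *\<^sub>R L v" for c v
      by (rule LIMSEQ_unique[OF L]) (auto intro: tendsto_mult L)
    show "norm (L v) \<le> norm v * C" for v
    proof (rule tendsto_upperbound[OF tendsto_norm[OF L]])
      have "norm (inner (x n) v) \<le> norm v * C" for n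
        using Cauchy_Schwarz_ineq2[of "x n" v] mult_right_mono[OF assms(1)[of n] norm_ge_zero[of v]]
        by (simp add: mult.commute)
      then show "\<forall>\<^sub>F n in sequentially. norm (inner (x n) v) \<le> norm v * C" by simp
    qed simp
  qed
  then obtain l where "\<And>v. L v = inner l v" using riesz_representation by blast
  with L that show ?thesis by metis
qed

lemma bounded_weakly_convergent_subsequence:
  fixes x :: "nat \<Rightarrow> 'a::{real_inner, complete_space, second_countable_topology}"
  assumes bd: "\<And>n. norm (x n) \<le> C"
  shows "\<exists>k l. strict_mono k \<and> (\<forall>v. (\<lambda>n. inner (x (k n)) v) \<longlonglongrightarrow> inner l v)"
proof -
  have "C \<ge> 0" using order_trans[OF norm_ge_zero bd] .
  obtain D :: "'a set" where "countable D" and D: "\<And>X. open X \<Longrightarrow> X \<noteq> {} \<Longrightarrow> \<exists>d\<in>D. d \<in> X"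
    by (erule countable_dense_setE)
  have inner_bd: "\<bar>inner (x n) v\<bar> \<le> C * norm v" for n v
    using Cauchy_Schwarz_ineq2[of "x n" v] mult_right_mono[OF bd[of n] norm_ge_zero[of v]] by simp
  \<comment> \<open>The diagonal argument over \<open>D\<close> asks for one bound valid for all v,
    hence the division by 1 + |v|.\<close>
  have "norm (inner (x n) v / (1 + norm v)) \<le> C" for n v
  proof -
    have "\<bar>inner (x n) v\<bar> \<le> C * (1 + norm v)"
      using inner_bd[of n v] \<open>C \<ge> 0\<close> by (simp add: algebra_simps)
    then show ?thesis by (simp add: divide_le_eq abs_mult add_pos_nonneg)
  qed
  then obtain k where k: "strict_mono (k :: nat \<Rightarrow> nat)"
    and k_conv: "\<And>v. v \<in> D \<Longrightarrow> \<exists>l. (\<lambda>n. inner (x (k n)) v / (1 + norm v)) \<longlonglongrightarrow> l"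
    using function_convergent_subsequence[OF \<open>countable D\<close>, of "\<lambda>n v. inner (x n) v / (1 + norm v)" C]
    by metis
  have conv_D: "convergent (\<lambda>n. inner (x (k n)) v)" if vD: "v \<in> D" for v
  proof -
    obtain l where "(\<lambda>n. inner (x (k n)) v / (1 + norm v)) \<longlonglongrightarrow> l"
      using k_conv[OF vD] by blast
    then have "(\<lambda>n. (1 + norm v) * (inner (x (k n)) v / (1 + norm v))) \<longlonglongrightarrow> (1 + norm v) * l"
      by (intro tendsto_intros)
    moreover have "1 + norm v \<noteq> 0" using norm_ge_zero[of v] by linarith
    ultimately show ?thesis by (auto simp: convergent_def)
  qed
  have "convergent (\<lambda>n. inner (x (k n)) v)" for v
  proof (rule Cauchy_convergent, rule metric_CauchyI)
    fix e :: real assume "e > 0"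
    define d where "d = e / (3 * (C + 1))"
    have "d > 0" using \<open>e > 0\<close> \<open>C \<ge> 0\<close> by (simp add: d_def)
    obtain u where u: "u \<in> D" "dist v u < d"
      using D[of "ball v d"] \<open>d > 0\<close> by (auto simp: mem_ball)
    have "C * norm (v - u) \<le> C * d"
      using u \<open>C \<ge> 0\<close> by (intro mult_left_mono) (auto simp: dist_norm)
    also have "C * d \<le> e / 3"
      using \<open>e > 0\<close> \<open>C \<ge> 0\<close> by (simp add: d_def field_simps)
    finally have app: "\<bar>inner (x n) v - inner (x n) u\<bar> \<le> e / 3" for n
      using inner_bd[of n "v - u"] by (simp add: inner_diff_right)
    from conv_D[OF u(1)] have "Cauchy (\<lambda>n. inner (x (k n)) u)"
      by (rule convergent_Cauchy)
    then obtain N where N: "\<And>m n. m \<ge> N \<Longrightarrow> n \<ge> N \<Longrightarrow> dist (inner (x (k m)) u) (inner (x (k n)) u) < e / 3"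
      using \<open>e > 0\<close> unfolding Cauchy_def by (metis divide_pos_pos zero_less_numeral)
    have "dist (inner (x (k m)) v) (inner (x (k n)) v) < e" if "m \<ge> N" "n \<ge> N" for m n
      using N[OF that] app[of "k m"] app[of "k n"] unfolding dist_real_def by linarith
    then show "\<exists>N. \<forall>m\<ge>N. \<forall>n\<ge>N. dist (inner (x (k m)) v) (inner (x (k n)) v) < e" by blast
  qed
  then obtain l where "\<And>v. (\<lambda>n. inner (x (k n)) v) \<longlonglongrightarrow> inner l v"
    using bounded_weak_limit[of "\<lambda>n. x (k n)" C] bd by metis
  with k show ?thesis by blast
qed

text \<open>Convergence of distances is asked only on a dense set \<open>D\<close>, so that a later
  application meets countably many exceptional null sets. It extends to all of \<open>Z\<close>
  because |x - z| is 1-Lipschitz in z.\<close>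

lemma opial:
  fixes x :: "nat \<Rightarrow> 'a::{real_inner, complete_space, second_countable_topology}"
  assumes dense: "Z \<subseteq> closure D" and "D \<noteq> {}"
    and conv: "\<And>z. z \<in> D \<Longrightarrow> convergent (\<lambda>n. norm (x n - z))"
    and cluster: "\<And>k l. strict_mono k \<Longrightarrow> (\<And>v. (\<lambda>n. inner (x (k n)) v) \<longlonglongrightarrow> inner l v) \<Longrightarrow> l \<in> Z"
  shows "\<exists>l\<in>Z. \<forall>v. (\<lambda>n. inner (x n) v) \<longlonglongrightarrow> inner l v"
proof -
  obtain d where "d \<in> D" using \<open>D \<noteq> {}\<close> by blast
  obtain K where K: "\<And>n. norm (norm (x n - d)) \<le> K"
    using convergent_imp_Bseq[OF conv[OF \<open>d \<in> D\<close>]] unfolding Bseq_def by blast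
  have bd: "norm (x n) \<le> K + norm d" for n
    using K[of n] norm_triangle_sub[of "x n" d] by simp
  have convZ: "convergent (\<lambda>n. norm (x n - z))" if zZ: "z \<in> Z" for z
  proof (rule Cauchy_convergent, rule metric_CauchyI)
    fix e :: real assume "e > 0"
    then have "e / 3 > 0" by simp
    moreover have "z \<in> closure D" using dense zZ by blast
    ultimately obtain u where u: "u \<in> D" "dist u z < e / 3"
      unfolding closure_approachable by blast
    have app: "\<bar>norm (x n - z) - norm (x n - u)\<bar> \<le> e / 3" for n
      using norm_triangle_ineq3[of "x n - z" "x n - u"] u by (simp add: dist_norm)
    obtain N where N: "\<And>m n. m \<ge> N \<Longrightarrow> n \<ge> N \<Longrightarrow> dist (norm (x m - u)) (norm (x n - u)) < e / 3"
      using convergent_Cauchy[OF conv[OF u(1)]] \<open>e > 0\<close> unfolding Cauchy_def by (metis divide_pos_pos zero_less_numeral)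
    have "dist (norm (x m - z)) (norm (x n - z)) < e" if "m \<ge> N" "n \<ge> N" for m n
      using N[OF that] app[of m] app[of n] unfolding dist_real_def by linarith
    then show "\<exists>N. \<forall>m\<ge>N. \<forall>n\<ge>N. dist (norm (x m - z)) (norm (x n - z)) < e" by blast
  qed
  obtain k l where k: "strict_mono (k :: nat \<Rightarrow> nat)" and l: "\<And>v. (\<lambda>n. inner (x (k n)) v) \<longlonglongrightarrow> inner l v"
    using bounded_weakly_convergent_subsequence[of x, OF bd] by blast
  have "l \<in> Z" by (rule cluster[OF k l])
  \<comment> \<open>Polarisation: the difference of the squared distances to l' and l determines <x
    n, l - l'>, which therefore converges along the whole sequence. Evaluated along both
    subsequences, its limit is <l, l - l'> and <l', l - l'>.\<close>
  have uniq: "l' = l" if k': "strict_mono k'" and l': "\<And>v. (\<lambda>n. inner (x (k' n)) v) \<longlonglongrightarrow> inner l' v" for k' l'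
  proof -
    have "l' \<in> Z" by (rule cluster[OF k' l'])
    obtain s t where "(\<lambda>n. norm (x n - l)) \<longlonglongrightarrow> s" "(\<lambda>n. norm (x n - l')) \<longlonglongrightarrow> t"
      using convZ \<open>l \<in> Z\<close> \<open>l' \<in> Z\<close> by (meson convergent_def)
    then have "(\<lambda>n. ((norm (x n - l'))\<^sup>2 - (norm (x n - l))\<^sup>2 + (norm l)\<^sup>2 - (norm l')\<^sup>2) / 2)
        \<longlonglongrightarrow> (t\<^sup>2 - s\<^sup>2 + (norm l)\<^sup>2 - (norm l')\<^sup>2) / 2"
      by (intro tendsto_intros) auto
    moreover have "((norm (x n - l'))\<^sup>2 - (norm (x n - l))\<^sup>2 + (norm l)\<^sup>2 - (norm l')\<^sup>2) / 2 = inner (x n) (l - l')" for n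
      by (simp add: power2_norm_eq_inner inner_simps inner_commute)
    ultimately have lim: "(\<lambda>n. inner (x n) (l - l')) \<longlonglongrightarrow> (t\<^sup>2 - s\<^sup>2 + (norm l)\<^sup>2 - (norm l')\<^sup>2) / 2" (is "_ \<longlonglongrightarrow> ?c")
      by simp
    have "inner l (l - l') = ?c" "inner l' (l - l') = ?c"
      using LIMSEQ_unique[OF l LIMSEQ_subseq_LIMSEQ[OF lim k, unfolded o_def]]
        LIMSEQ_unique[OF l' LIMSEQ_subseq_LIMSEQ[OF lim k', unfolded o_def]] by auto
    then have "inner (l - l') (l - l') = 0" by (simp add: inner_simps)
    then show ?thesis by simp
  qed
  have "(\<lambda>n. inner (x n) v) \<longlonglongrightarrow> inner l v" for v
  proof (rule ccontr)
    assume "\<not> (\<lambda>n. inner (x n) v) \<longlonglongrightarrow> inner l v"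
    then obtain e where "e > 0" and e: "\<And>N. \<exists>n\<ge>N. dist (inner (x n) v) (inner l v) \<ge> e"
      unfolding lim_sequentially by (meson not_less)
    have "infinite {n. dist (inner (x n) v) (inner l v) \<ge> e}"
      unfolding infinite_nat_iff_unbounded_le using e by auto
    from infinite_enumerate[OF this] obtain h :: "nat \<Rightarrow> nat"
      where h: "strict_mono h" and he: "\<And>n. dist (inner (x (h n)) v) (inner l v) \<ge> e" by auto
    obtain j l' where j: "strict_mono (j :: nat \<Rightarrow> nat)" and l': "\<And>v. (\<lambda>n. inner (x (h (j n))) v) \<longlonglongrightarrow> inner l' v"
      using bounded_weakly_convergent_subsequence[of "\<lambda>n. x (h n)", OF bd] by blast
    have "l' = l"
      using uniq[OF strict_mono_o[OF h j]] l' by simp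
    then obtain N where "\<And>n. n \<ge> N \<Longrightarrow> dist (inner (x (h (j n))) v) (inner l v) < e"
      using l'[of v] \<open>e > 0\<close> unfolding lim_sequentially by blast
    with he show False by (meson not_less order_refl)
  qed
  with \<open>l \<in> Z\<close> show ?thesis by blast
qed

text \<open>For w in A z, monotonicity gives <x n - z, (u n + B (x n)) - (w + B z)> \<ge> 0. The
  first factor converges weakly and is bounded, the residual strongly, so the inequality passes to
  the limit and \<open>zer_sum_maximality\<close> applies.\<close>

lemma weak_cluster_zer_sum:
  fixes A :: "'a::{real_inner, complete_space} \<Rightarrow> 'a set"
  assumes A: "maximally_monotone A" and Bm: "monotone_fun B"
    and "\<mu> > 0" and B: "\<mu>-lipschitz_on UNIV B"
    and u: "\<And>n. u n \<in> A (x n)" and q: "(\<lambda>n. u n + B (x n)) \<longlonglongrightarrow> 0"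
    and bd: "\<And>n. norm (x n) \<le> C"
    and l: "\<And>v. (\<lambda>n. inner (x n) v) \<longlonglongrightarrow> inner l v"
  shows "l \<in> zer_sum A B"
proof (rule zer_sum_maximality[OF A \<open>\<mu> > 0\<close> B])
  fix z w assume w: "w \<in> A z"
  have "inner (x n - z) (u n + B (x n)) + inner (x n - z) (- B z - w) \<ge> 0" for n
  proof -
    have "0 \<le> inner (x n - z) (u n - w)"
      using A u w by (auto simp: maximally_monotone_def intro: monotone_opD)
    moreover have "0 \<le> inner (x n - z) (B (x n) - B z)"
      using Bm by (simp add: monotone_fun_def)
    ultimately show ?thesis by (simp add: inner_simps)
  qed
  moreover have "(\<lambda>n. inner (x n - z) (u n + B (x n)) + inner (x n - z) (- B z - w))
      \<longlonglongrightarrow> 0 + (inner l (- B z - w) - inner z (- B z - w))"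
  proof (intro tendsto_add)
    show "(\<lambda>n. inner (x n - z) (- B z - w)) \<longlonglongrightarrow> inner l (- B z - w) - inner z (- B z - w)"
      using tendsto_diff[OF l tendsto_const] by (simp add: inner_diff_left)
    show "(\<lambda>n. inner (x n - z) (u n + B (x n))) \<longlonglongrightarrow> 0"
    proof (rule Lim_null_comparison)
      have "norm (inner (x n - z) (u n + B (x n))) \<le> (C + norm z) * norm (u n + B (x n))" for n
      proof -
        have "norm (x n - z) \<le> C + norm z"
          using norm_triangle_ineq4[of "x n" z] bd[of n] by simp
        from mult_right_mono[OF this norm_ge_zero[of "u n + B (x n)"]]
        show ?thesis using Cauchy_Schwarz_ineq2[of "x n - z" "u n + B (x n)"] by simp
      qed
      then show "\<forall>\<^sub>F n in sequentially. norm (inner (x n - z) (u n + B (x n))) \<le> (C + norm z) * norm (u n + B (x n))"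
        by simp
      show "(\<lambda>n. (C + norm z) * norm (u n + B (x n))) \<longlonglongrightarrow> 0"
        using tendsto_mult_right_zero[OF tendsto_norm_zero[OF q]] .
    qed
  qed
  ultimately have "0 \<le> 0 + (inner l (- B z - w) - inner z (- B z - w))"
    by (intro LIMSEQ_le_const) auto
  then show "0 \<le> inner (l - z) (- B z - w)"
    by (simp add: inner_diff_left)
qed

section \<open>The Lyapunov function\<close>

text \<open>Here p, q, x are consecutive iterates and \<gamma> is the step that produced x. The last
  norm is the distance from x to the reflected point 2 q - p at which \<open>B\<close> was
  evaluated.\<close>

definition lyapunov :: "('a::real_inner \<Rightarrow> 'a) \<Rightarrow> real \<Rightarrow> 'a \<Rightarrow> real \<Rightarrow> 'a \<Rightarrow> 'a \<Rightarrow> 'a \<Rightarrow> real" where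
  "lyapunov B \<mu> a \<gamma> p q x =
     (norm (x - a))\<^sup>2 / \<gamma> + 2 * inner (B (2 *\<^sub>R q - p) - B a) (x - q)
     + (1 / \<gamma> + \<mu> * (1 + sqrt 2)) * (norm (x - q))\<^sup>2 + \<mu> * (norm ((x - q) - (q - p)))\<^sup>2"

text \<open>Because (sqrt 2 - 1) (sqrt 2 + 1) = 1, the right end of the step interval is the
  reciprocal of \<mu> (1 + sqrt 2).\<close>

lemma inverse_step_ge:
  assumes "\<mu> > 0" "\<gamma> \<in> {0<..<(sqrt 2 - 1) / \<mu>}"
  shows "\<mu> * (1 + sqrt 2) \<le> 1 / \<gamma>"
proof -
  have "\<gamma> * \<mu> < sqrt 2 - 1" using assms by (simp add: pos_less_divide_eq)
  then have "\<gamma> * \<mu> * (1 + sqrt 2) \<le> (sqrt 2 - 1) * (1 + sqrt 2)"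
    by (intro mult_right_mono) auto
  also have "\<dots> = 1" by (simp add: algebra_simps)
  finally show ?thesis using assms by (simp add: pos_le_divide_eq mult.commute mult.left_commute)
qed

lemma two_mult_le_squares: "2 * (s * t) \<le> s\<^sup>2 + (t::real)\<^sup>2"
  using zero_le_power2[of "s - t"] by (simp add: power2_diff)

text \<open>Young's inequality with the reciprocal weights 1 + sqrt 2 and sqrt 2 - 1.\<close>

lemma two_mult_le_sqrt2: "2 * (s * t) \<le> (1 + sqrt 2) * s\<^sup>2 + (sqrt 2 - 1) * (t::real)\<^sup>2"
proof -
  have inv: "(sqrt 2 - 1) * (1 + sqrt 2) = 1" by (simp add: algebra_simps)
  have "0 \<le> (sqrt 2 - 1) * ((1 + sqrt 2) * s - t)\<^sup>2" by simp
  also have "\<dots> = ((sqrt 2 - 1) * (1 + sqrt 2)) * ((1 + sqrt 2) * s\<^sup>2)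
      - ((sqrt 2 - 1) * (1 + sqrt 2)) * (2 * (s * t)) + (sqrt 2 - 1) * t\<^sup>2"
    by (simp only: power2_eq_square) algebra
  finally show ?thesis unfolding inv by simp
qed

text \<open>Only the cross term can be negative. Splitting the reflected point as x minus the second
  difference bounds it below by -\<mu> (X^2 + 2 D^2 + P^2). The last two squares are covered by the
  other terms, and 1 / \<gamma> \<ge> 2 \<mu> leaves \<mu> X^2.\<close>

lemma lyapunov_ge:
  assumes B: "\<mu>-lipschitz_on UNIV B" and "\<mu> > 0" and \<gamma>: "\<mu> * (1 + sqrt 2) \<le> 1 / \<gamma>"
  shows "\<mu> * (norm (x - a))\<^sup>2 \<le> lyapunov B \<mu> a \<gamma> p q x"
proof -
  define X D P where "X = norm (x - a)" and "D = norm (x - q)" and "P = norm ((x - q) - (q - p))"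
  have sqrt2: "sqrt 2 \<ge> 1" by simp
  have eq: "2 *\<^sub>R q - p - a = (x - a) - ((x - q) - (q - p))"
    by (simp add: scaleR_2)
  have "norm (B (2 *\<^sub>R q - p) - B a) \<le> \<mu> * norm (2 *\<^sub>R q - p - a)"
    using lipschitz_onD[OF B, of "2 *\<^sub>R q - p" a] by (simp add: dist_norm)
  also have "\<dots> \<le> \<mu> * (X + P)"
    unfolding eq X_def P_def using \<open>\<mu> > 0\<close> by (intro mult_left_mono norm_triangle_ineq4) auto
  finally have "norm (B (2 *\<^sub>R q - p) - B a) * D \<le> \<mu> * (X + P) * D"
    by (intro mult_right_mono) (auto simp: D_def)
  moreover have "\<bar>inner (B (2 *\<^sub>R q - p) - B a) (x - q)\<bar> \<le> norm (B (2 *\<^sub>R q - p) - B a) * D"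
    unfolding D_def by (rule Cauchy_Schwarz_ineq2)
  ultimately have "2 * inner (B (2 *\<^sub>R q - p) - B a) (x - q) \<ge> - (\<mu> * (2 * (X * D) + 2 * (P * D)))"
    by (simp add: algebra_simps)
  moreover have "\<mu> * (2 * (X * D) + 2 * (P * D)) \<le> \<mu> * (X\<^sup>2 + 2 * D\<^sup>2 + P\<^sup>2)"
    using \<open>\<mu> > 0\<close> two_mult_le_squares[of X D] two_mult_le_squares[of P D]
    by (intro mult_left_mono) auto
  moreover have "\<mu> * 2 * X\<^sup>2 \<le> X\<^sup>2 / \<gamma>"
  proof -
    have "\<mu> * 2 \<le> \<mu> * (1 + sqrt 2)" using \<open>\<mu> > 0\<close> sqrt2 by (intro mult_left_mono) auto
    then have "\<mu> * 2 \<le> 1 / \<gamma>" using \<gamma> by simp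
    from mult_right_mono[OF this zero_le_power2[of X]] show ?thesis by simp
  qed
  moreover have "\<mu> * 2 * D\<^sup>2 \<le> (1 / \<gamma> + \<mu> * (1 + sqrt 2)) * D\<^sup>2"
  proof -
    have "\<mu> * 2 \<le> \<mu> * (1 + sqrt 2)" "0 \<le> \<mu> * (1 + sqrt 2)"
      using \<open>\<mu> > 0\<close> sqrt2 by (auto intro!: mult_left_mono)
    then show ?thesis using \<gamma> by (intro mult_right_mono) auto
  qed
  ultimately show ?thesis
    unfolding lyapunov_def X_def[symmetric] D_def[symmetric] P_def[symmetric] by (simp add: algebra_simps)
qed

text \<open>\<open>B\<close> is evaluated at the reflected point, so its monotonicity yields a sign
  for <2 x2 - x1 - a, b2 - ba> and not for <x3 - a, b2 - ba>. The difference <P3, b2 - ba> has to be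
  split into the change of the cross term and products with b2 - b1. One of these is bounded by the
  Lipschitz property, the other by monotonicity of \<open>A\<close> between consecutive
  iterates.\<close>

lemma lyapunov_descent:
  fixes B :: "'a::real_inner \<Rightarrow> 'a"
  assumes A: "monotone_op A" and Bm: "monotone_fun B" and B: "\<mu>-lipschitz_on UNIV B" and "\<mu> > 0"
    and a: "- B a \<in> A a"
    and x2: "(1 / g) *\<^sub>R (x1 - g *\<^sub>R (B (2 *\<^sub>R x1 - x0) + e1) - x2) \<in> A x2"
    and x3: "(1 / h) *\<^sub>R (x2 - h *\<^sub>R (B (2 *\<^sub>R x2 - x1) + e2) - x3) \<in> A x3"
    and gh: "0 < g" "g \<le> h" "\<mu> * (1 + sqrt 2) \<le> 1 / g"
    and \<tau>: "\<tau> \<le> 2 / h - 1 / g - \<mu> * (1 + sqrt 2)"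
  shows "lyapunov B \<mu> a h x1 x2 x3 + \<tau> * (norm (x3 - x2))\<^sup>2
       \<le> lyapunov B \<mu> a g x0 x1 x2 - 2 * inner e2 (x3 - a) - 2 * inner (e2 - e1) (x3 - x2)"
proof -
  define b1 b2 ba where "b1 = B (2 *\<^sub>R x1 - x0)" and "b2 = B (2 *\<^sub>R x2 - x1)" and "ba = B a"
  define d2 d3 P2 P3 where "d2 = x2 - x1" and "d3 = x3 - x2" and "P2 = d2 - (x1 - x0)" and "P3 = d3 - d2"
  define G H where "G = 1 / g" and "H = 1 / h"
  have "h > 0" using gh by simp
  have HG: "H \<le> G" unfolding G_def H_def using gh by (simp add: frac_le)
  have u3: "- (H *\<^sub>R d3) - b2 - e2 \<in> A x3"
  proof -
    have "(1 / h) *\<^sub>R (x2 - h *\<^sub>R (B (2 *\<^sub>R x2 - x1) + e2) - x3) = - (H *\<^sub>R d3) - b2 - e2"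
      using \<open>h > 0\<close> by (simp add: H_def d3_def b2_def algebra_simps)
    with x3 show ?thesis by simp
  qed
  have u2: "- (G *\<^sub>R d2) - b1 - e1 \<in> A x2"
  proof -
    have "(1 / g) *\<^sub>R (x1 - g *\<^sub>R (B (2 *\<^sub>R x1 - x0) + e1) - x2) = - (G *\<^sub>R d2) - b1 - e1"
      using gh by (simp add: G_def d2_def b1_def algebra_simps)
    with x2 show ?thesis by simp
  qed
  have "2 * inner (x3 - a) d3 = (norm (x3 - a))\<^sup>2 + (norm d3)\<^sup>2 - (norm (x2 - a))\<^sup>2"
    by (simp add: d3_def power2_norm_eq_inner inner_simps inner_commute)
  then have "H * (2 * inner (x3 - a) d3) = H * ((norm (x3 - a))\<^sup>2 + (norm d3)\<^sup>2 - (norm (x2 - a))\<^sup>2)"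
    by simp
  moreover have "0 \<le> inner (x3 - a) ((- (H *\<^sub>R d3) - b2 - e2) - (- ba))"
    using monotone_opD[OF A u3 a] by (simp add: ba_def)
  ultimately have 1: "H * (norm (x3 - a))\<^sup>2 + H * (norm d3)\<^sup>2 - H * (norm (x2 - a))\<^sup>2
      + 2 * inner (x3 - a) (b2 - ba) + 2 * inner (x3 - a) e2 \<le> 0"
    by (simp add: inner_diff_right inner_add_right inner_minus_right right_diff_distrib distrib_left)
  have "0 \<le> inner (2 *\<^sub>R x2 - x1 - a) (b2 - ba)"
    using Bm by (simp add: monotone_fun_def b2_def ba_def)
  moreover have "2 *\<^sub>R x2 - x1 - a = (x3 - a) - P3"
    by (simp add: P3_def d3_def d2_def scaleR_2)
  ultimately have 2: "inner P3 (b2 - ba) \<le> inner (x3 - a) (b2 - ba)"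
    by (simp add: inner_diff_left)
  have "2 * inner d3 d2 = (norm d2)\<^sup>2 + (norm d3)\<^sup>2 - (norm P3)\<^sup>2"
    by (simp add: P3_def power2_norm_eq_inner inner_simps inner_commute)
  then have "G * (2 * inner d3 d2) = G * ((norm d2)\<^sup>2 + (norm d3)\<^sup>2 - (norm P3)\<^sup>2)"
    by simp
  moreover have "0 \<le> inner d3 ((- (H *\<^sub>R d3) - b2 - e2) - (- (G *\<^sub>R d2) - b1 - e1))"
    using monotone_opD[OF A u3 u2] by (simp add: d3_def)
  ultimately have 3: "2 * inner d3 (b2 - b1) \<le> G * (norm d2)\<^sup>2 + G * (norm d3)\<^sup>2 - G * (norm P3)\<^sup>2
      - 2 * (H * (norm d3)\<^sup>2) - 2 * inner d3 (e2 - e1)"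
    by (simp add: inner_diff_right inner_minus_right right_diff_distrib distrib_left power2_norm_eq_inner)
  \<comment> \<open>Weight s = 1 + sqrt 2 on d2 and 1/s on P3. The product with P2 adds 1 to the
    coefficient of P3 and the new Lyapunov value another 1; the total 2 + 1/s = s is what
    \<open>7\<close> absorbs.\<close>
  have 4: "2 * inner (d2 - d3) (b2 - b1)
     \<le> \<mu> * (1 + sqrt 2) * (norm d2)\<^sup>2 + \<mu> * sqrt 2 * (norm P3)\<^sup>2 + \<mu> * (norm P2)\<^sup>2"
  proof -
    have eq: "2 *\<^sub>R x2 - x1 - (2 *\<^sub>R x1 - x0) = d2 + P2"
      by (simp add: d2_def P2_def scaleR_2)
    have "norm (b2 - b1) \<le> \<mu> * norm (d2 + P2)"
      using lipschitz_onD[OF B, of "2 *\<^sub>R x2 - x1" "2 *\<^sub>R x1 - x0"]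
      by (simp add: dist_norm b1_def b2_def eq)
    also have "\<dots> \<le> \<mu> * (norm d2 + norm P2)"
      using \<open>\<mu> > 0\<close> by (intro mult_left_mono norm_triangle_ineq) auto
    finally have "norm P3 * norm (b2 - b1) \<le> norm P3 * (\<mu> * (norm d2 + norm P2))"
      by (intro mult_left_mono) auto
    moreover have "inner (d2 - d3) (b2 - b1) \<le> norm P3 * norm (b2 - b1)"
      using norm_cauchy_schwarz[of "d2 - d3" "b2 - b1"] by (simp add: P3_def norm_minus_commute)
    ultimately have "2 * inner (d2 - d3) (b2 - b1)
        \<le> \<mu> * (2 * (norm d2 * norm P3) + 2 * (norm P2 * norm P3))"
      by (simp add: algebra_simps)
    also have "\<dots> \<le> \<mu> * (((1 + sqrt 2) * (norm d2)\<^sup>2 + (sqrt 2 - 1) * (norm P3)\<^sup>2)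
        + ((norm P2)\<^sup>2 + (norm P3)\<^sup>2))"
      using \<open>\<mu> > 0\<close> by (intro mult_left_mono add_mono two_mult_le_sqrt2 two_mult_le_squares) auto
    finally show ?thesis by (simp add: algebra_simps)
  qed
  \<comment> \<open>The term 2 <d2, b2 - b1> is deliberately split along d2 - d3 and d3, to match
    \<open>4\<close> and \<open>3\<close>.\<close>
  have 5: "- 2 * inner P3 (b2 - ba) = - 2 * inner (b2 - ba) d3 + 2 * inner (b1 - ba) d2
      + 2 * inner (d2 - d3) (b2 - b1) + 2 * inner d3 (b2 - b1)"
    by (simp add: P3_def inner_simps inner_commute)
  \<comment> \<open>Here the nondecreasing step sizes allow the weights of the squared distances to
    telescope.\<close>
  have 6: "H * (norm (x2 - a))\<^sup>2 \<le> G * (norm (x2 - a))\<^sup>2"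
    using HG by (intro mult_right_mono) auto
  have 7: "\<mu> * (1 + sqrt 2) * (norm P3)\<^sup>2 \<le> G * (norm P3)\<^sup>2"
    using gh by (intro mult_right_mono) (auto simp: G_def)
  \<comment> \<open>\<open>1\<close> supplies H and \<open>3\<close> supplies 2 H - G in front of
    |d3|^2; the new Lyapunov value takes H + \<mu> (1 + sqrt 2). The remainder is the quantity
    bounded below by \<tau>.\<close>
  have 8: "\<tau> * (norm d3)\<^sup>2 \<le> (2 * H - G - \<mu> * (1 + sqrt 2)) * (norm d3)\<^sup>2"
    using \<tau> by (intro mult_right_mono) (auto simp: G_def H_def)
  have V3: "lyapunov B \<mu> a h x1 x2 x3 = H * (norm (x3 - a))\<^sup>2 + 2 * inner (b2 - ba) d3
      + (H + \<mu> * (1 + sqrt 2)) * (norm d3)\<^sup>2 + \<mu> * (norm P3)\<^sup>2"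
    by (simp add: lyapunov_def b2_def ba_def d3_def P3_def d2_def H_def)
  have V2: "lyapunov B \<mu> a g x0 x1 x2 = G * (norm (x2 - a))\<^sup>2 + 2 * inner (b1 - ba) d2
      + (G + \<mu> * (1 + sqrt 2)) * (norm d2)\<^sup>2 + \<mu> * (norm P2)\<^sup>2"
    by (simp add: lyapunov_def b1_def ba_def P2_def d2_def G_def)
  have "inner e2 (x3 - a) = inner (x3 - a) e2" "inner (e2 - e1) (x3 - x2) = inner d3 (e2 - e1)"
    by (simp_all add: inner_commute d3_def)
  with 1 2 3 4 5 6 7 8 show ?thesis
    unfolding V2 V3 d3_def[symmetric] by (simp add: algebra_simps)
qed

text \<open>Writing x3 - a as (x2 - a) + (x3 - x2) isolates <e2, -2 (x2 - a)>, where x2 does not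
  depend on the fresh error. All remaining noise is paired with x3 - x2 and costs half of \<tau> by
  Young; 16 / \<tau> is 2 / \<tau> times a generous factor 8.\<close>

lemma lyapunov_descent_noise:
  fixes B :: "'a::real_inner \<Rightarrow> 'a"
  assumes A: "monotone_op A" and Bm: "monotone_fun B" and B: "\<mu>-lipschitz_on UNIV B" and "\<mu> > 0"
    and a: "- B a \<in> A a"
    and x2: "(1 / g) *\<^sub>R (x1 - g *\<^sub>R (B (2 *\<^sub>R x1 - x0) + e1) - x2) \<in> A x2"
    and x3: "(1 / h) *\<^sub>R (x2 - h *\<^sub>R (B (2 *\<^sub>R x2 - x1) + e2) - x3) \<in> A x3"
    and gh: "0 < g" "g \<le> h" "\<mu> * (1 + sqrt 2) \<le> 1 / g"
    and \<tau>: "\<tau> \<le> 2 / h - 1 / g - \<mu> * (1 + sqrt 2)" "0 < \<tau>"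
  shows "lyapunov B \<mu> a h x1 x2 x3 + \<tau> / 2 * (norm (x3 - x2))\<^sup>2
       \<le> lyapunov B \<mu> a g x0 x1 x2 + 16 / \<tau> * ((norm e1)\<^sup>2 + (norm e2)\<^sup>2) + inner e2 (- 2 *\<^sub>R (x2 - a))"
proof -
  define D N where "D = norm (x3 - x2)" and "N = norm (e1 - 2 *\<^sub>R e2)"
  have "inner (e1 - 2 *\<^sub>R e2) (x3 - x2) \<le> N * D"
    unfolding N_def D_def by (rule norm_cauchy_schwarz)
  moreover have "2 * (N * D) \<le> \<tau> / 2 * D\<^sup>2 + 2 / \<tau> * N\<^sup>2"
  proof -
    have "0 \<le> (\<tau> * D - 2 * N)\<^sup>2 / (2 * \<tau>)" using \<open>\<tau> > 0\<close> by simp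
    also have "\<dots> = \<tau> / 2 * D\<^sup>2 + 2 / \<tau> * N\<^sup>2 - 2 * (N * D)"
      using \<open>\<tau> > 0\<close> by (simp add: power2_eq_square field_simps)
    finally show ?thesis by simp
  qed
  moreover have "2 / \<tau> * N\<^sup>2 \<le> 2 / \<tau> * (8 * ((norm e1)\<^sup>2 + (norm e2)\<^sup>2))"
  proof (rule mult_left_mono)
    have "N \<le> norm e1 + 2 * norm e2"
      using norm_triangle_ineq4[of e1 "2 *\<^sub>R e2"] by (simp add: N_def)
    then have "N\<^sup>2 \<le> (norm e1 + 2 * norm e2)\<^sup>2"
      by (intro power_mono) (auto simp: N_def)
    also have "\<dots> \<le> 8 * ((norm e1)\<^sup>2 + (norm e2)\<^sup>2)"
    proof -
      have "4 * (norm e1 * norm e2) \<le> 4 * (norm e2)\<^sup>2 + 7 * (norm e1)\<^sup>2"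
        using two_mult_le_squares[of "norm e1" "norm e2"] zero_le_power2[of "norm e1"] zero_le_power2[of "norm e2"]
        by linarith
      then show ?thesis by (simp add: power2_sum power_mult_distrib)
    qed
    finally show "N\<^sup>2 \<le> 8 * ((norm e1)\<^sup>2 + (norm e2)\<^sup>2)" .
  qed (use \<open>\<tau> > 0\<close> in simp)
  moreover have "- 2 * inner e2 (x3 - a) - 2 * inner (e2 - e1) (x3 - x2)
     = 2 * inner (e1 - 2 *\<^sub>R e2) (x3 - x2) + inner e2 (- 2 *\<^sub>R (x2 - a))"
    by (simp add: inner_simps algebra_simps)
  ultimately show ?thesis
    using lyapunov_descent[OF assms(1-11)] unfolding D_def[symmetric] by (simp add: algebra_simps)
qed

section \<open>Convergence of quasi-supermartingales\<close>

text \<open>Doob's strategy as a two-state machine: a position is opened when s falls below a and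
  closed when s exceeds b. The state at n depends on s 0, ..., s n only. Completed upcrossings are
  the moments of closing.\<close>

primrec upcrossing :: "(nat \<Rightarrow> real) \<Rightarrow> real \<Rightarrow> real \<Rightarrow> nat \<Rightarrow> bool" where
  "upcrossing s a b 0 \<longleftrightarrow> s 0 < a"
| "upcrossing s a b (Suc n) \<longleftrightarrow> (if upcrossing s a b n then s (Suc n) \<le> b else s (Suc n) < a)"

definition upcrossings :: "(nat \<Rightarrow> real) \<Rightarrow> real \<Rightarrow> real \<Rightarrow> nat \<Rightarrow> nat" where
  "upcrossings s a b n = (\<Sum>k<n. of_bool (upcrossing s a b k \<and> \<not> upcrossing s a b (Suc k)))"

lemma upcrossings_0: "upcrossings s a b 0 = 0"
  by (simp add: upcrossings_def)

lemma upcrossings_Suc: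
  "upcrossings s a b (Suc n) =
     upcrossings s a b n + of_bool (upcrossing s a b n \<and> \<not> upcrossing s a b (Suc n))"
  by (simp add: upcrossings_def del: upcrossing.simps)

lemma upcrossings_le: "upcrossings s a b n \<le> n"
  by (induction n) (simp_all add: upcrossings_0 upcrossings_Suc of_bool_def del: upcrossing.simps)

text \<open>Each closed position earned at least b - a. The induction needs the extra summand s n -
  a, the value of a position still open.\<close>

lemma upcrossings_gain_aux:
  assumes "a < b"
  shows "(b - a) * real (upcrossings s a b n) + (if upcrossing s a b n then s n - a else 0)
    \<le> (\<Sum>k<n. of_bool (upcrossing s a b k) * (s (Suc k) - s k))"
proof (induction n)
  case 0
  then show ?case by (simp add: upcrossings_0)
next
  case (Suc n)
  define G where "G = (\<Sum>k<n. of_bool (upcrossing s a b k) * (s (Suc k) - s k))"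
  define C where "C = (b - a) * real (upcrossings s a b n)"
  have "(b - a) * real (upcrossings s a b (Suc n)) =
      C + (b - a) * of_bool (upcrossing s a b n \<and> \<not> upcrossing s a b (Suc n))"
    by (simp add: C_def upcrossings_Suc distrib_left del: upcrossing.simps)
  moreover have "C + (if upcrossing s a b n then s n - a else 0) \<le> G"
    using Suc by (simp add: C_def G_def)
  ultimately show ?case
    using assms by (simp flip: G_def) auto
qed

text \<open>Nonnegativity of s limits the loss on an open position to a.\<close>

lemma upcrossings_gain:
  assumes "a < b" "0 \<le> a" "\<And>n. 0 \<le> s n"
  shows "(b - a) * real (upcrossings s a b n)
    \<le> a + (\<Sum>k<n. of_bool (upcrossing s a b k) * (s (Suc k) - s k))"
  using upcrossings_gain_aux[OF assms(1), of s n] assms(2) assms(3)[of n] by (auto split: if_splits)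

text \<open>With finitely many closings the state is eventually constant: permanently open means s
  \<le> b, permanently closed means s \<ge> a.\<close>

lemma upcrossings_bounded_dichotomy:
  assumes bd: "\<And>n. upcrossings s a b n \<le> N"
  shows "(\<forall>\<^sub>F n in sequentially. s n \<le> b) \<or> (\<forall>\<^sub>F n in sequentially. a \<le> s n)"
proof -
  let ?u = "upcrossing s a b"
  define K where "K = {k. ?u k \<and> \<not> ?u (Suc k)}"
  have "finite K"
  proof (rule ccontr)
    assume "infinite K"
    then obtain T where T: "T \<subseteq> K" "finite T" "card T = Suc N"
      using infinite_arbitrarily_large by blast
    then obtain n where n: "T \<subseteq> {..<n}"
      using finite_nat_iff_bounded by blast
    have "upcrossings s a b n = card ({..<n} \<inter> K)"
      by (simp add: upcrossings_def K_def of_bool_def sum.If_cases flip: Collect_conj_eq)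
    also have "\<dots> \<ge> card T"
      using T n by (intro card_mono) auto
    finally show False using bd[of n] T by simp
  qed
  then obtain m where m: "\<And>n. n \<ge> m \<Longrightarrow> n \<notin> K"
    by (metis finite_nat_iff_bounded lessThan_iff not_less subsetD)
  show ?thesis
  proof (cases "\<exists>k\<ge>m. ?u k")
    case True
    then obtain k where k: "k \<ge> m" "?u k" by blast
    have u: "?u n" if "n \<ge> k" for n
      using that
    proof (induction rule: dec_induct)
      case (step n)
      then show ?case using m[of n] k by (auto simp: K_def)
    qed (use k in simp)
    have "s n \<le> b" if "n \<ge> Suc k" for n
      using that u[of "n - 1"] u[of n] by (cases n) auto
    then show ?thesis unfolding eventually_sequentially by blast
  next
    case False
    have "a \<le> s n" if n: "n \<ge> Suc m" for n
    proof -
      from n obtain k where k: "n = Suc k" "k \<ge> m" by (cases n) auto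
      then have "\<not> ?u k" "\<not> ?u (Suc k)" using False le_SucI by blast+
      then show ?thesis by (metis k(1) not_less upcrossing.simps(2))
    qed
    then show ?thesis unfolding eventually_sequentially by blast
  qed
qed

text \<open>The limit is the infimum of the eventual upper bounds. Rational thresholds suffice,
  which keeps later exceptional sets countable in number; \<open>freq\<close> excludes divergence to
  infinity.\<close>

lemma convergent_of_dichotomy:
  fixes s :: "nat \<Rightarrow> real"
  assumes nonneg: "\<And>n. 0 \<le> s n"
    and dich: "\<And>a b. a \<in> \<rat> \<Longrightarrow> b \<in> \<rat> \<Longrightarrow> 0 \<le> a \<Longrightarrow> a < b \<Longrightarrow>
      (\<forall>\<^sub>F n in sequentially. s n \<le> b) \<or> (\<forall>\<^sub>F n in sequentially. a \<le> s n)"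
    and freq: "\<exists>\<^sub>F n in sequentially. s n \<le> C"
  shows "convergent s"
proof -
  define E where "E = {c. \<forall>\<^sub>F n in sequentially. s n \<le> c}"
  define L where "L = Inf E"
  obtain a b :: real where ab: "a \<in> \<rat>" "b \<in> \<rat>" "max C 0 < a" "a < b"
    by (meson Rats_dense_in_real less_add_one)
  have "\<not> (\<forall>\<^sub>F n in sequentially. a \<le> s n)"
  proof
    assume "\<forall>\<^sub>F n in sequentially. a \<le> s n"
    then have "\<forall>\<^sub>F n in sequentially. \<not> s n \<le> C"
      by eventually_elim (use ab in auto)
    with freq show False by (simp add: frequently_def)
  qed
  then have "b \<in> E" using dich[OF ab(1,2)] ab by (auto simp: E_def)
  have lower: "0 \<le> c" if "c \<in> E" for c
  proof -
    from that obtain n where "s n \<le> c"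
      unfolding E_def eventually_sequentially by blast
    with nonneg[of n] show ?thesis by simp
  qed
  have bdd: "bdd_below E" using lower by (rule bdd_belowI)
  have "L \<ge> 0" unfolding L_def using \<open>b \<in> E\<close> lower by (intro cInf_greatest) auto
  have "s \<longlonglongrightarrow> L"
  proof (rule order_tendstoI)
    fix c assume "L < c"
    then obtain c' where "c' \<in> E" "c' < c"
      unfolding L_def using cInf_lessD \<open>b \<in> E\<close> by (metis empty_iff)
    then show "\<forall>\<^sub>F n in sequentially. s n < c"
      unfolding E_def by (auto elim: eventually_mono)
  next
    fix c assume "c < L"
    show "\<forall>\<^sub>F n in sequentially. c < s n"
    proof (cases "c < 0")
      case True
      then show ?thesis using nonneg by (intro always_eventually allI) (meson less_le_trans)
    next
      case False
      obtain p where p: "p \<in> \<rat>" "c < p" "p < L" using Rats_dense_in_real[OF \<open>c < L\<close>] by blast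
      obtain q where q: "q \<in> \<rat>" "p < q" "q < L" using Rats_dense_in_real[OF \<open>p < L\<close>] by blast
      have "q \<notin> E" using q(3) bdd unfolding L_def by (meson cInf_lower not_less)
      then have "\<forall>\<^sub>F n in sequentially. p \<le> s n"
        using dich[OF p(1) q(1)] p q False by (auto simp: E_def)
      then show ?thesis by eventually_elim (use p in simp)
    qed
  qed
  then show ?thesis by (rule convergentI)
qed

lemma AE_summable_of_summable_integral:
  fixes f :: "nat \<Rightarrow> 'w \<Rightarrow> real"
  assumes int: "\<And>n. integrable M (f n)" and nonneg: "\<And>n w. w \<in> space M \<Longrightarrow> 0 \<le> f n w"
    and sum: "summable (\<lambda>n. \<integral>w. f n w \<partial>M)"
  shows "AE w in M. summable (\<lambda>n. f n w)"
proof -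
  have [measurable]: "f n \<in> borel_measurable M" for n using int by auto
  have "(\<integral>\<^sup>+w. (\<Sum>n. ennreal (f n w)) \<partial>M) = (\<Sum>n. \<integral>\<^sup>+w. ennreal (f n w) \<partial>M)"
    by (rule nn_integral_suminf) measurable
  also have "\<dots> = (\<Sum>n. ennreal (\<integral>w. f n w \<partial>M))"
    by (intro suminf_cong nn_integral_eq_integral int AE_I2 nonneg)
  also have "\<dots> = ennreal (\<Sum>n. \<integral>w. f n w \<partial>M)"
    by (intro suminf_ennreal2 Bochner_Integration.integral_nonneg nonneg sum)
  finally have "(\<integral>\<^sup>+w. (\<Sum>n. ennreal (f n w)) \<partial>M) \<noteq> \<infinity>" by simp
  then have "AE w in M. (\<Sum>n. ennreal (f n w)) \<noteq> \<infinity>"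
    by (intro nn_integral_PInf_AE) auto
  with AE_space show ?thesis
  proof eventually_elim
    case (elim w)
    then show ?case by (intro summable_suminf_not_top nonneg) (auto simp: infinity_ennreal_def)
  qed
qed

text \<open>The drift hypothesis integrates over events of \<open>F n\<close> in place of
  conditional expectations. Applied to the events of holding a position it gives Doob's upcrossing
  inequality with the extra total drift.\<close>

lemma quasi_supermartingale_convergent:
  fixes S :: "nat \<Rightarrow> 'w \<Rightarrow> real"
  assumes "finite_measure M"
    and sub: "\<And>n. subalgebra M (F n)" "\<And>n. subalgebra (F (Suc n)) (F n)"
    and S: "\<And>n. S n \<in> borel_measurable (F n)" "\<And>n. integrable M (S n)"
    and nonneg: "\<And>n w. w \<in> space M \<Longrightarrow> 0 \<le> S n w"
    and drift: "\<And>n H. H \<in> sets (F n) \<Longrightarrow> (\<integral>w. indicator H w * (S (Suc n) w - S n w) \<partial>M) \<le> \<delta> n"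
    and \<delta>: "summable \<delta>" "\<And>n. 0 \<le> \<delta> n"
  shows "AE w in M. convergent (\<lambda>n. S n w)"
proof -
  interpret finite_measure M by fact
  have spF: "space (F n) = space M" for n using sub(1) by (simp add: subalgebra_def)
  have SM [measurable]: "S n \<in> borel_measurable M" for n
    using measurable_from_subalg[OF sub(1) S(1)] .
  let ?u = "\<lambda>a b w. upcrossing (\<lambda>n. S n w) a b"
  let ?c = "\<lambda>a b w. upcrossings (\<lambda>n. S n w) a b"
  have uF: "{w \<in> space M. ?u a b w n} \<in> sets (F n)" for a b n
  proof (induction n)
    case 0
    have "{w \<in> space (F 0). S 0 w < a} \<in> sets (F 0)"
      using S(1)[of 0] by measurable
    then show ?case by (simp add: spF)
  next
    case (Suc n)
    have [measurable]: "{w \<in> space M. ?u a b w n} \<in> sets (F (Suc n))"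
      using Suc sub(2)[of n] by (auto simp: subalgebra_def)
    have [measurable]: "S (Suc n) \<in> borel_measurable (F (Suc n))" by (rule S)
    have "{w \<in> space M. ?u a b w (Suc n)} =
      ({w \<in> space M. ?u a b w n} \<inter> {w \<in> space (F (Suc n)). S (Suc n) w \<le> b})
      \<union> ({w \<in> space (F (Suc n)). S (Suc n) w < a} - {w \<in> space M. ?u a b w n})"
      by (auto simp: spF split: if_splits)
    also have "\<dots> \<in> sets (F (Suc n))" by measurable
    finally show ?case .
  qed
  have uM [measurable]: "Measurable.pred M (\<lambda>w. ?u a b w n)" for a b n
    using uF[of a b n] sub(1)[of n] unfolding pred_def by (auto simp: subalgebra_def)
  have cM [measurable]: "(\<lambda>w. real (?c a b w n)) \<in> borel_measurable M" for a b n
    unfolding upcrossings_def of_nat_sum of_bool_def of_nat_numeral by measurable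
  have \<delta>_le: "(\<Sum>k<n. \<delta> k) \<le> suminf \<delta>" for n
    using \<delta> by (intro sum_le_suminf) auto
  have bounded: "AE w in M. \<exists>N. \<forall>n. ?c a b w n \<le> N" if ab: "0 \<le> a" "a < b" for a b
  proof -
    \<comment> \<open>Doob's bound for the mean number of upcrossings: the possible loss a plus the
      total drift, divided by the gain b - a per crossing.\<close>
    define K where "K = (a * measure M (space M) + suminf \<delta>) / (b - a)"
    have mean: "(\<integral>\<^sup>+w. ennreal (real (?c a b w n)) \<partial>M) \<le> ennreal K" for n
    proof -
      have int_c: "integrable M (\<lambda>w. real (?c a b w n))"
      proof (rule integrable_const_bound[of _ "real n"])
        show "AE w in M. norm (real (?c a b w n)) \<le> real n" by (simp add: upcrossings_le)
      qed simp
      have int_g: "integrable M (\<lambda>w. of_bool (?u a b w k) * (S (Suc k) w - S k w))" for k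
      proof (rule Bochner_Integration.integrable_bound)
        show "integrable M (\<lambda>w. S (Suc k) w - S k w)" using S(2) by simp
        show "(\<lambda>w. of_bool (?u a b w k) * (S (Suc k) w - S k w)) \<in> borel_measurable M"
          unfolding of_bool_def by measurable
      qed auto
      have gain: "(\<integral>w. of_bool (?u a b w k) * (S (Suc k) w - S k w) \<partial>M) \<le> \<delta> k" for k
      proof -
        have "(\<integral>w. of_bool (?u a b w k) * (S (Suc k) w - S k w) \<partial>M)
          = (\<integral>w. indicator {w \<in> space M. ?u a b w k} w * (S (Suc k) w - S k w) \<partial>M)"
          by (intro Bochner_Integration.integral_cong) (auto simp: indicator_def)
        then show ?thesis using drift[OF uF] by simp
      qed
      have "(b - a) * (\<integral>w. real (?c a b w n) \<partial>M) = (\<integral>w. (b - a) * real (?c a b w n) \<partial>M)"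
        by simp
      also have "\<dots> \<le> (\<integral>w. a + (\<Sum>k<n. of_bool (?u a b w k) * (S (Suc k) w - S k w)) \<partial>M)"
      proof (rule integral_mono_AE)
        show "AE w in M. (b - a) * real (?c a b w n) \<le> a + (\<Sum>k<n. of_bool (?u a b w k) * (S (Suc k) w - S k w))"
          using ab nonneg by (intro AE_I2 upcrossings_gain) auto
        show "integrable M (\<lambda>w. a + (\<Sum>k<n. of_bool (?u a b w k) * (S (Suc k) w - S k w)))"
          by (intro Bochner_Integration.integrable_add Bochner_Integration.integrable_sum int_g) simp
      qed (use int_c in simp)
      also have "\<dots> = a * measure M (space M) + (\<Sum>k<n. \<integral>w. of_bool (?u a b w k) * (S (Suc k) w - S k w) \<partial>M)"
        by (subst Bochner_Integration.integral_add)
          (auto simp: int_g Bochner_Integration.integral_sum simp del: sum_of_bool_mult_eq)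
      also have "\<dots> \<le> a * measure M (space M) + suminf \<delta>"
        using sum_mono[of "{..<n}", OF gain] \<delta>_le[of n] by (meson add_left_mono order_trans)
      finally have "(\<integral>w. real (?c a b w n) \<partial>M) \<le> K"
        using ab by (simp add: K_def pos_le_divide_eq mult.commute)
      then show ?thesis
        using int_c by (subst nn_integral_eq_integral) (auto intro: ennreal_leI)
    qed
    have inc: "incseq (\<lambda>n w. ennreal (real (?c a b w n)))"
      by (intro incseq_SucI le_funI ennreal_leI) (simp add: upcrossings_Suc)
    have "(\<integral>\<^sup>+w. (SUP n. ennreal (real (?c a b w n))) \<partial>M) = (SUP n. \<integral>\<^sup>+w. ennreal (real (?c a b w n)) \<partial>M)"
      using inc by (intro nn_integral_monotone_convergence_SUP) auto
    also have "\<dots> \<le> ennreal K" by (intro SUP_least mean)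
    finally have "(\<integral>\<^sup>+w. (SUP n. ennreal (real (?c a b w n))) \<partial>M) \<noteq> \<infinity>"
      by (auto simp: top_unique)
    then have "AE w in M. (SUP n. ennreal (real (?c a b w n))) \<noteq> \<infinity>"
      by (intro nn_integral_PInf_AE) auto
    then show ?thesis
    proof eventually_elim
      case (elim w)
      then obtain r where r: "(SUP n. ennreal (real (?c a b w n))) = ennreal r" "r \<ge> 0"
        by (metis ennreal_cases infinity_ennreal_def)
      have "?c a b w n \<le> nat \<lceil>r\<rceil>" for n
      proof -
        have "ennreal (real (?c a b w n)) \<le> ennreal r"
          unfolding r(1)[symmetric] by (rule SUP_upper) simp
        then show ?thesis using r(2) by (simp add: ennreal_le_iff) linarith
      qed
      then show ?case by blast
    qed
  qed
  have "AE w in M. \<forall>p. case p of (a, b) \<Rightarrow> real_of_rat a \<ge> 0 \<longrightarrow> a < b \<longrightarrow> (\<exists>N. \<forall>n. ?c (real_of_rat a) (real_of_rat b) w n \<le> N)"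
  proof (subst AE_all_countable, intro allI)
    fix p :: "rat \<times> rat"
    obtain a b where p: "p = (a, b)" by fastforce
    show "AE w in M. case p of (a, b) \<Rightarrow> real_of_rat a \<ge> 0 \<longrightarrow> a < b \<longrightarrow> (\<exists>N. \<forall>n. ?c (real_of_rat a) (real_of_rat b) w n \<le> N)"
    proof (cases "real_of_rat a \<ge> 0 \<and> a < b")
      case True
      then show ?thesis using bounded[of "real_of_rat a" "real_of_rat b"] by (simp add: p of_rat_less)
    next
      case False
      then show ?thesis by (auto simp: p)
    qed
  qed
  \<comment> \<open>The means stay bounded, so Fatou makes the lower limit finite; this supplies the
    frequent bound that rules out divergence.\<close>
  moreover have "AE w in M. liminf (\<lambda>n. ennreal (S n w)) \<noteq> \<infinity>"
  proof (rule nn_integral_PInf_AE)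
    have mean: "(\<integral>w. S n w \<partial>M) \<le> (\<integral>w. S 0 w \<partial>M) + (\<Sum>k<n. \<delta> k)" for n
    proof (induction n)
      case (Suc n)
      have "(\<integral>w. indicator (space M) w * (S (Suc n) w - S n w) \<partial>M) = (\<integral>w. S (Suc n) w - S n w \<partial>M)"
        by (intro Bochner_Integration.integral_cong) auto
      also have "\<dots> = (\<integral>w. S (Suc n) w \<partial>M) - (\<integral>w. S n w \<partial>M)"
        using S(2) by simp
      finally show ?case using Suc drift[of "space M" n] sets.top[of "F n"] by (simp add: spF)
    qed simp
    have "(\<integral>\<^sup>+w. liminf (\<lambda>n. ennreal (S n w)) \<partial>M) \<le> liminf (\<lambda>n. \<integral>\<^sup>+w. ennreal (S n w) \<partial>M)"
      by (intro nn_integral_liminf) measurable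
    also have "\<dots> \<le> liminf (\<lambda>n. ennreal ((\<integral>w. S 0 w \<partial>M) + suminf \<delta>))"
    proof (intro Liminf_mono always_eventually allI)
      fix n
      have "(\<integral>\<^sup>+w. ennreal (S n w) \<partial>M) = ennreal (\<integral>w. S n w \<partial>M)"
        using nonneg by (intro nn_integral_eq_integral S AE_I2)
      also have "\<dots> \<le> ennreal ((\<integral>w. S 0 w \<partial>M) + suminf \<delta>)"
        using mean[of n] \<delta>_le[of n] by (intro ennreal_leI) linarith
      finally show "(\<integral>\<^sup>+w. ennreal (S n w) \<partial>M) \<le> ennreal ((\<integral>w. S 0 w \<partial>M) + suminf \<delta>)" .
    qed
    also have "\<dots> = ennreal ((\<integral>w. S 0 w \<partial>M) + suminf \<delta>)" by (simp add: Liminf_const)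
    finally show "(\<integral>\<^sup>+w. liminf (\<lambda>n. ennreal (S n w)) \<partial>M) \<noteq> \<infinity>" by (auto simp: top_unique)
  qed measurable
  ultimately show ?thesis using AE_space
  proof eventually_elim
    case (elim w)
    obtain C where C: "liminf (\<lambda>n. ennreal (S n w)) = ennreal C" "C \<ge> 0"
      using elim by (metis ennreal_cases infinity_ennreal_def)
    have "\<exists>\<^sub>F n in sequentially. S n w \<le> C + 1"
    proof (rule ccontr)
      assume "\<not> (\<exists>\<^sub>F n in sequentially. S n w \<le> C + 1)"
      then have "\<forall>\<^sub>F n in sequentially. ennreal (C + 1) \<le> ennreal (S n w)"
        unfolding not_frequently by eventually_elim (auto intro: ennreal_leI)
      then have "ennreal (C + 1) \<le> ennreal C"
        unfolding C(1)[symmetric] by (rule Liminf_bounded)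
      then show False using C(2) by (simp add: ennreal_le_iff)
    qed
    then show "convergent (\<lambda>n. S n w)"
    proof (rule convergent_of_dichotomy[rotated 2])
      fix a b :: real assume ab: "a \<in> \<rat>" "b \<in> \<rat>" "0 \<le> a" "a < b"
      then obtain a' b' where "a = real_of_rat a'" "b = real_of_rat b'" by (auto elim!: Rats_cases)
      then show "(\<forall>\<^sub>F n in sequentially. S n w \<le> b) \<or> (\<forall>\<^sub>F n in sequentially. a \<le> S n w)"
        using elim(1) ab upcrossings_bounded_dichotomy[of "\<lambda>n. S n w" a b] by (auto simp: of_rat_less)
    qed (use elim nonneg in auto)
  qed
qed

section \<open>Localised almost-supermartingales and weak measurability\<close>

text \<open>Orthogonality of a martingale difference to an \<open>F\<close>-measurable vector. It is
  immediate for simple z; the general case follows by dominated convergence, with simple functions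
  of norm at most twice that of z.\<close>

lemma integral_inner_eq_zero:
  fixes e z :: "'w \<Rightarrow> 'a::{real_inner, banach, second_countable_topology}"
  assumes sub: "subalgebra M F" and e: "integrable M e" and z: "z \<in> borel_measurable F"
    and zero: "\<And>S. S \<in> sets F \<Longrightarrow> (LINT w:S|M. e w) = 0"
    and int: "integrable M (\<lambda>w. norm (e w) * norm (z w))"
  shows "(\<integral>w. inner (e w) (z w) \<partial>M) = 0"
proof -
  have sp: "space F = space M" and sets: "sets F \<subseteq> sets M" using sub by (auto simp: subalgebra_def)
  obtain s where s_all: "\<forall>i. simple_function F (s i)" "\<forall>w\<in>space M. (\<lambda>i. s i w) \<longlonglongrightarrow> z w"
      "\<forall>i. \<forall>w\<in>space M. norm (s i w) \<le> 2 * norm (z w)"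
    using borel_measurable_implies_sequence_metric[OF z, of 0] by (auto simp: sp)
  then have s: "\<And>i. simple_function F (s i)"
    and lim: "\<And>w. w \<in> space M \<Longrightarrow> (\<lambda>i. s i w) \<longlonglongrightarrow> z w"
    and bd: "\<And>i w. w \<in> space M \<Longrightarrow> norm (s i w) \<le> 2 * norm (z w)"
    by blast+
  have [measurable]: "e \<in> borel_measurable M" using e by auto
  have [measurable]: "z \<in> borel_measurable M" using measurable_from_subalg[OF sub z] .
  have [measurable]: "s i \<in> borel_measurable M" for i
    using measurable_from_subalg[OF sub borel_measurable_simple_function[OF s]] .
  have "(\<integral>w. inner (e w) (s i w) \<partial>M) = 0" for i
  proof -
    let ?S = "\<lambda>v. s i -` {v} \<inter> space M"
    have S: "?S v \<in> sets F" for v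
      using simple_functionD(2)[OF s, of i "{v}"] by (simp add: sp)
    have fin: "finite (s i ` space M)"
      using simple_functionD(1)[OF s, of i] by (simp add: sp)
    have int_S: "integrable M (\<lambda>w. indicator (?S v) w *\<^sub>R e w)" for v
      using S sets e by (intro integrable_mult_indicator) auto
    have "inner (e w) (s i w) = (\<Sum>v\<in>s i ` space M. inner (indicator (?S v) w *\<^sub>R e w) v)" if "w \<in> space M" for w
    proof -
      have "(\<Sum>v\<in>s i ` space M. inner (indicator (?S v) w *\<^sub>R e w) v)
        = (\<Sum>v\<in>s i ` space M. if v = s i w then inner (e w) v else 0)"
        using that by (intro sum.cong) (auto simp: indicator_def)
      also have "\<dots> = inner (e w) (s i w)" using fin that by simp
      finally show ?thesis ..
    qed
    then have "(\<integral>w. inner (e w) (s i w) \<partial>M)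
        = (\<integral>w. (\<Sum>v\<in>s i ` space M. inner (indicator (?S v) w *\<^sub>R e w) v) \<partial>M)"
      by (intro Bochner_Integration.integral_cong) auto
    also have "\<dots> = (\<Sum>v\<in>s i ` space M. \<integral>w. inner (indicator (?S v) w *\<^sub>R e w) v \<partial>M)"
      by (intro Bochner_Integration.integral_sum integrable_inner_left int_S)
    also have "\<dots> = (\<Sum>v\<in>s i ` space M. inner (\<integral>w. indicator (?S v) w *\<^sub>R e w \<partial>M) v)"
      by (intro sum.cong refl integral_inner_left int_S)
    also have "\<dots> = 0"
      using zero[OF S] by (intro sum.neutral) (simp add: set_lebesgue_integral_def)
    finally show ?thesis .
  qed
  moreover have "(\<lambda>i. \<integral>w. inner (e w) (s i w) \<partial>M) \<longlonglongrightarrow> (\<integral>w. inner (e w) (z w) \<partial>M)"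
  proof (rule integral_dominated_convergence)
    show "integrable M (\<lambda>w. 2 * (norm (e w) * norm (z w)))" using int by simp
    show "AE w in M. (\<lambda>i. inner (e w) (s i w)) \<longlonglongrightarrow> inner (e w) (z w)"
      using lim by (intro AE_I2 tendsto_intros)
    show "AE w in M. norm (inner (e w) (s i w)) \<le> 2 * (norm (e w) * norm (z w))" for i
    proof (rule AE_I2)
      fix w assume "w \<in> space M"
      then have "norm (e w) * norm (s i w) \<le> norm (e w) * (2 * norm (z w))"
        by (intro mult_left_mono bd) auto
      with Cauchy_Schwarz_ineq2[of "e w" "s i w"]
      show "norm (inner (e w) (s i w)) \<le> 2 * (norm (e w) * norm (z w))" by simp
    qed
  qed auto
  ultimately have "(\<lambda>_. 0) \<longlonglongrightarrow> (\<integral>w. inner (e w) (z w) \<partial>M)" by simp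
  from LIMSEQ_unique[OF this tendsto_const] show ?thesis .
qed

text \<open>Robbins and Siegmund's theorem on the event \<open>\<Inter>n. I n\<close>; multiplying \<open>V n\<close> by the
  decreasing indicator of \<open>I n\<close> keeps the drift inequality because \<open>V n \<ge> 0\<close>.\<close>

lemma almost_supermartingale_localized:
  fixes V U Z N :: "nat \<Rightarrow> 'w \<Rightarrow> real" and I :: "nat \<Rightarrow> 'w set"
  assumes fin: "finite_measure M"
    and sub: "\<And>n. subalgebra M (F n)" "\<And>n. subalgebra (F (Suc n)) (F n)"
    and V: "\<And>n. V n \<in> borel_measurable (F n)" "\<And>n w. w \<in> space M \<Longrightarrow> 0 \<le> V n w"
    and U: "\<And>n. U n \<in> borel_measurable M" "\<And>n w. w \<in> space M \<Longrightarrow> 0 \<le> U n w"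
    and Z: "\<And>n w. w \<in> space M \<Longrightarrow> 0 \<le> Z n w"
    and I: "\<And>n. I n \<in> sets (F n)" "\<And>n. I (Suc n) \<subseteq> I n"
    and desc: "\<And>n w. w \<in> space M \<Longrightarrow> V (Suc n) w + U n w \<le> V n w + Z n w + N n w"
    and int_V: "\<And>n. integrable M (\<lambda>w. indicator (I n) w * V n w)"
      "\<And>n. integrable M (\<lambda>w. indicator (I n) w * V (Suc n) w)"
    and int_Z: "\<And>n. integrable M (\<lambda>w. indicator (I n) w * Z n w)"
    and int_N: "\<And>n. integrable M (\<lambda>w. indicator (I n) w * N n w)"
    and N: "\<And>n H. H \<in> sets (F n) \<Longrightarrow> H \<subseteq> I n \<Longrightarrow> (\<integral>w. indicator H w * N n w \<partial>M) = 0"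
    and summable: "summable (\<lambda>n. \<integral>w. indicator (I n) w * Z n w \<partial>M)"
  shows "AE w in M. (\<forall>n. w \<in> I n) \<longrightarrow> convergent (\<lambda>n. V n w) \<and> summable (\<lambda>n. U n w)"
proof -
  define S where "S n w = indicator (I n) w * V n w" for n w
  define \<delta> where "\<delta> n = (\<integral>w. indicator (I n) w * Z n w \<partial>M)" for n
  have \<delta>_nonneg: "0 \<le> \<delta> n" for n
    unfolding \<delta>_def using Z by (intro Bochner_Integration.integral_nonneg) auto
  have spF: "space (F n) = space M" for n using sub(1) by (simp add: subalgebra_def)
  have F_M: "H \<in> sets M" if "H \<in> sets (F n)" for H n
    using that sub(1) by (auto simp: subalgebra_def)
  have S_step: "S (Suc n) w \<le> indicator (I n) w * V (Suc n) w" if "w \<in> space M" for n w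
    using I(2)[of n] V(2)[OF that] by (auto simp: S_def indicator_def)
  have S_int: "integrable M (S n)" for n using int_V(1) unfolding S_def[abs_def] .
  have mult_ind: "integrable M (\<lambda>w. indicator H w * f w)" if "H \<in> sets (F n)" "integrable M f" for H n and f :: "'w \<Rightarrow> real"
    using integrable_mult_indicator[OF F_M[OF that(1)] that(2)] by simp
  \<comment> \<open>Used twice: dropping U gives the quasi-supermartingale property, keeping it with
    H the whole space gives summability of U.\<close>
  have drift: "(\<integral>w. indicator H w * (S (Suc n) w - S n w + indicator (I n) w * U n w) \<partial>M) \<le> \<delta> n"
    if H: "H \<in> sets (F n)" and int_U: "integrable M (\<lambda>w. indicator (I n) w * U n w)" for H n
  proof -
    have "(\<integral>w. indicator H w * (S (Suc n) w - S n w + indicator (I n) w * U n w) \<partial>M)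
      \<le> (\<integral>w. indicator H w * (indicator (I n) w * Z n w) + indicator H w * (indicator (I n) w * N n w) \<partial>M)"
    proof (rule integral_mono)
      show "integrable M (\<lambda>w. indicator H w * (S (Suc n) w - S n w + indicator (I n) w * U n w))"
        by (intro mult_ind[OF H] Bochner_Integration.integrable_add Bochner_Integration.integrable_diff S_int int_U)
      show "integrable M (\<lambda>w. indicator H w * (indicator (I n) w * Z n w) + indicator H w * (indicator (I n) w * N n w))"
        by (intro Bochner_Integration.integrable_add mult_ind[OF H] int_Z int_N)
      fix w assume w: "w \<in> space M"
      show "indicator H w * (S (Suc n) w - S n w + indicator (I n) w * U n w)
        \<le> indicator H w * (indicator (I n) w * Z n w) + indicator H w * (indicator (I n) w * N n w)"
        using S_step[OF w, of n] desc[OF w, of n] by (auto simp: S_def indicator_def split: if_splits)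
    qed
    also have "\<dots> = (\<integral>w. indicator H w * (indicator (I n) w * Z n w) \<partial>M) + (\<integral>w. indicator H w * (indicator (I n) w * N n w) \<partial>M)"
      by (intro Bochner_Integration.integral_add mult_ind[OF H] int_Z int_N)
    also have "(\<integral>w. indicator H w * (indicator (I n) w * N n w) \<partial>M) = (\<integral>w. indicator (H \<inter> I n) w * N n w \<partial>M)"
      by (intro Bochner_Integration.integral_cong) (auto simp: indicator_def)
    also have "\<dots> = 0" using H I(1) by (intro N) auto
    also have "(\<integral>w. indicator H w * (indicator (I n) w * Z n w) \<partial>M) \<le> \<delta> n"
      unfolding \<delta>_def using Z by (intro integral_mono mult_ind[OF H] int_Z) (auto simp: indicator_def)
    finally show ?thesis by simp
  qed
  \<comment> \<open>On \<open>I n\<close> the descent inequality and V (Suc n) \<ge> 0 squeeze U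
    between 0 and V + Z + N.\<close>
  have int_U: "integrable M (\<lambda>w. indicator (I n) w * U n w)" for n
  proof (rule Bochner_Integration.integrable_bound)
    show "integrable M (\<lambda>w. indicator (I n) w * V n w + indicator (I n) w * Z n w + indicator (I n) w * N n w)"
      by (intro Bochner_Integration.integrable_add int_V int_Z int_N)
    have [measurable]: "I n \<in> sets M" using F_M[OF I(1)] .
    show "(\<lambda>w. indicator (I n) w * U n w) \<in> borel_measurable M" using U(1) by measurable
    show "AE w in M. norm (indicator (I n) w * U n w)
      \<le> norm (indicator (I n) w * V n w + indicator (I n) w * Z n w + indicator (I n) w * N n w)"
    proof (rule AE_I2)
      fix w assume w: "w \<in> space M"
      show "norm (indicator (I n) w * U n w)
        \<le> norm (indicator (I n) w * V n w + indicator (I n) w * Z n w + indicator (I n) w * N n w)"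
        using desc[OF w, of n] V(2)[OF w, of "Suc n"] U(2)[OF w, of n] by (auto simp: indicator_def)
    qed
  qed
  have "AE w in M. convergent (\<lambda>n. S n w)"
  proof (rule quasi_supermartingale_convergent[where F = F and S = S and \<delta> = \<delta>, OF fin sub])
    show "S n \<in> borel_measurable (F n)" for n
      unfolding S_def[abs_def] using V(1) I(1) by measurable
    show "(\<integral>w. indicator H w * (S (Suc n) w - S n w) \<partial>M) \<le> \<delta> n" if H: "H \<in> sets (F n)" for n H
    proof (rule order_trans[OF integral_mono drift[OF H int_U]])
      show "integrable M (\<lambda>w. indicator H w * (S (Suc n) w - S n w))"
        by (intro mult_ind[OF H] Bochner_Integration.integrable_diff S_int)
      show "integrable M (\<lambda>w. indicator H w * (S (Suc n) w - S n w + indicator (I n) w * U n w))"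
        by (intro mult_ind[OF H] Bochner_Integration.integrable_add Bochner_Integration.integrable_diff S_int int_U)
      show "indicator H w * (S (Suc n) w - S n w) \<le> indicator H w * (S (Suc n) w - S n w + indicator (I n) w * U n w)"
        if "w \<in> space M" for w
        using U(2)[OF that, of n] by (auto simp: indicator_def)
    qed
    show "summable \<delta>" unfolding \<delta>_def[abs_def] by (rule summable)
  qed (use S_int V(2) \<delta>_nonneg in \<open>auto simp: S_def\<close>)
  moreover have "AE w in M. summable (\<lambda>n. indicator (I n) w * U n w)"
  proof (rule AE_summable_of_summable_integral[OF int_U])
    \<comment> \<open>The drift estimate on the whole space, telescoped.\<close>
    have bound: "(\<Sum>k<n. \<integral>w. indicator (I k) w * U k w \<partial>M) + (\<integral>w. S n w \<partial>M) \<le> (\<integral>w. S 0 w \<partial>M) + (\<Sum>k<n. \<delta> k)" for n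
    proof (induction n)
      case (Suc n)
      have "(\<integral>w. indicator (space M) w * (S (Suc n) w - S n w + indicator (I n) w * U n w) \<partial>M)
        = (\<integral>w. (S (Suc n) w - S n w) + indicator (I n) w * U n w \<partial>M)"
        by (intro Bochner_Integration.integral_cong) auto
      also have "\<dots> = (\<integral>w. S (Suc n) w - S n w \<partial>M) + (\<integral>w. indicator (I n) w * U n w \<partial>M)"
        by (intro Bochner_Integration.integral_add Bochner_Integration.integrable_diff S_int int_U)
      also have "(\<integral>w. S (Suc n) w - S n w \<partial>M) = (\<integral>w. S (Suc n) w \<partial>M) - (\<integral>w. S n w \<partial>M)"
        by (intro Bochner_Integration.integral_diff S_int)
      finally show ?case using Suc drift[of "space M" n, OF _ int_U] sets.top[of "F n"] by (simp add: spF)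
    qed simp
    have "(\<Sum>k<n. \<integral>w. indicator (I k) w * U k w \<partial>M) \<le> (\<integral>w. S 0 w \<partial>M) + suminf \<delta>" for n
    proof -
      have "(\<Sum>k<n. \<delta> k) \<le> suminf \<delta>"
        using summable \<delta>_nonneg unfolding \<delta>_def[abs_def] by (intro sum_le_suminf) auto
      moreover have "0 \<le> (\<integral>w. S n w \<partial>M)"
        using V(2) by (intro Bochner_Integration.integral_nonneg) (simp add: S_def)
      ultimately show ?thesis using bound[of n] by linarith
    qed
    then show "summable (\<lambda>n. \<integral>w. indicator (I n) w * U n w \<partial>M)"
      using U(2) by (intro summableI_nonneg_bounded Bochner_Integration.integral_nonneg) auto
  qed (use U(2) in simp)
  ultimately show ?thesis
  proof eventually_elim
    case (elim w)
    show ?case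
    proof
      assume "\<forall>n. w \<in> I n"
      with elim show "convergent (\<lambda>n. V n w) \<and> summable (\<lambda>n. U n w)" by (simp add: S_def)
    qed
  qed
qed

section \<open>Localisation by conditional variances\<close>

text \<open>The summation includes index n: the n-th conditional expectation is already
  \<open>F n\<close>-measurable, so the event lies in \<open>F n\<close> and still controls
  \<open>g n\<close>, which is not. Values in \<open>ennreal\<close> avoid any integrability demand
  on g.\<close>

definition cond_exp_sublevel ::
  "'w measure \<Rightarrow> (nat \<Rightarrow> 'w measure) \<Rightarrow> (nat \<Rightarrow> 'w \<Rightarrow> real) \<Rightarrow> real \<Rightarrow> nat \<Rightarrow> 'w set" where
  "cond_exp_sublevel M F g c n =
     {w \<in> space M. (\<Sum>k\<le>n. nn_cond_exp M (F k) (\<lambda>w. ennreal (g k w)) w) \<le> ennreal c}"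

lemma cond_exp_sublevel_Suc_subset:
  "cond_exp_sublevel M F g c (Suc n) \<subseteq> cond_exp_sublevel M F g c n"
proof
  fix w assume w: "w \<in> cond_exp_sublevel M F g c (Suc n)"
  let ?e = "\<lambda>n. nn_cond_exp M (F n) (\<lambda>w. ennreal (g n w)) w"
  have "(\<Sum>k\<le>n. ?e k) \<le> (\<Sum>k\<le>Suc n. ?e k)" by simp
  also have "\<dots> \<le> ennreal c" using w unfolding cond_exp_sublevel_def by blast
  finally show "w \<in> cond_exp_sublevel M F g c n"
    using w unfolding cond_exp_sublevel_def by blast
qed

lemma cond_exp_sublevel_antimono:
  "m \<le> n \<Longrightarrow> cond_exp_sublevel M F g c n \<subseteq> cond_exp_sublevel M F g c m"
  by (rule lift_Suc_antimono_le[of "cond_exp_sublevel M F g c", OF cond_exp_sublevel_Suc_subset])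

lemma cond_exp_sublevel_exhausts:
  assumes "w \<in> space M" "(\<Sum>n. nn_cond_exp M (F n) (\<lambda>w. ennreal (g n w)) w) < \<infinity>"
  obtains c :: nat where "\<And>n. w \<in> cond_exp_sublevel M F g (real c) n"
proof -
  let ?e = "\<lambda>n. nn_cond_exp M (F n) (\<lambda>w. ennreal (g n w))"
  obtain r where r: "(\<Sum>n. ?e n w) = ennreal r" "r \<ge> 0"
    using assms(2) by (cases "\<Sum>n. ?e n w") auto
  obtain c :: nat where "r \<le> real c" using real_arch_simple by blast
  then have c: "(\<Sum>n. ?e n w) \<le> ennreal (real c)" unfolding r by (rule ennreal_leI)
  show ?thesis
  proof (rule that)
    fix n
    have "(\<Sum>k\<le>n. ?e k w) \<le> (\<Sum>n. ?e n w)"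
      unfolding lessThan_Suc_atMost[symmetric] by (intro sum_le_suminf) auto
    also note c
    finally show "w \<in> cond_exp_sublevel M F g (real c) n"
      using assms(1) by (simp add: cond_exp_sublevel_def)
  qed
qed

lemma cond_exp_sublevel_sets:
  assumes sub: "\<And>m n. m \<le> n \<Longrightarrow> subalgebra (F n) (F m)" and sp: "\<And>n. space (F n) = space M"
  shows "cond_exp_sublevel M F g c n \<in> sets (F n)"
proof -
  have "nn_cond_exp M (F k) (\<lambda>w. ennreal (g k w)) \<in> borel_measurable (F n)" if "k \<le> n" for k
    by (rule measurable_from_subalg[OF sub[OF that] borel_measurable_nn_cond_exp])
  then have [measurable]:
    "(\<lambda>w. \<Sum>k\<le>n. nn_cond_exp M (F k) (\<lambda>w. ennreal (g k w)) w) \<in> borel_measurable (F n)"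
    by (intro borel_measurable_sum) auto
  have "{w \<in> space (F n). (\<Sum>k\<le>n. nn_cond_exp M (F k) (\<lambda>w. ennreal (g k w)) w) \<le> ennreal c} \<in> sets (F n)"
    by measurable
  then show ?thesis by (simp add: cond_exp_sublevel_def sp)
qed

text \<open>On each path the localised conditional expectations sum to at most c, hence so do their
  integrals; the defining property of conditional expectation on \<open>F n\<close>-events moves
  this bound to g.\<close>

lemma cond_exp_sublevel_summable:
  fixes g :: "nat \<Rightarrow> 'w \<Rightarrow> real"
  assumes "prob_space M" and subM: "\<And>n. subalgebra M (F n)"
    and sub: "\<And>m n. m \<le> n \<Longrightarrow> subalgebra (F n) (F m)"
    and g [measurable]: "\<And>n. g n \<in> borel_measurable M" and nonneg: "\<And>n w. 0 \<le> g n w" and "0 \<le> c"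
  shows "integrable M (\<lambda>w. indicator (cond_exp_sublevel M F g c n) w * g n w)"
    and "summable (\<lambda>n. \<integral>w. indicator (cond_exp_sublevel M F g c n) w * g n w \<partial>M)"
proof -
  interpret prob_space M by fact
  let ?I = "cond_exp_sublevel M F g c"
  let ?e = "\<lambda>n. nn_cond_exp M (F n) (\<lambda>w. ennreal (g n w))"
  have spF: "space (F n) = space M" for n using subM by (simp add: subalgebra_def)
  have IF: "?I n \<in> sets (F n)" for n by (rule cond_exp_sublevel_sets[OF sub spF])
  have IM [measurable]: "?I n \<in> sets M" for n using IF[of n] subM[of n] by (auto simp: subalgebra_def)
  have [measurable]: "?e n \<in> borel_measurable M" for n
    by (rule measurable_from_subalg[OF subM borel_measurable_nn_cond_exp])
  \<comment> \<open>The events decrease: on the last one every indicator is 1 and its definition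
    gives the bound, off it the last summand vanishes.\<close>
  have "(\<Sum>n<m. indicator (?I n) w * ?e n w) \<le> ennreal c" for m w
  proof (induction m)
    case (Suc m)
    show ?case
    proof (cases "w \<in> ?I m")
      case True
      then have "w \<in> ?I n" if "n \<le> m" for n
        using cond_exp_sublevel_antimono[of n m M F g c] that by blast
      then have "(\<Sum>n<Suc m. indicator (?I n) w * ?e n w) = (\<Sum>n\<le>m. ?e n w)"
        unfolding lessThan_Suc_atMost by (intro sum.cong) auto
      with True show ?thesis by (simp add: cond_exp_sublevel_def)
    qed (use Suc in simp)
  qed simp
  then have le: "(\<integral>\<^sup>+w. (\<Sum>n<m. indicator (?I n) w * ?e n w) \<partial>M) \<le> ennreal c" for m
    using nn_integral_mono[of M "\<lambda>w. \<Sum>n<m. indicator (?I n) w * ?e n w" "\<lambda>_. ennreal c"]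
    by (simp add: emeasure_space_1)
  have eq: "(\<integral>\<^sup>+w. indicator (?I n) w * ?e n w \<partial>M) = (\<integral>\<^sup>+w. ennreal (indicator (?I n) w * g n w) \<partial>M)" for n
  proof -
    interpret finite_measure_subalgebra M "F n"
      by unfold_locales (rule subM)
    have "(\<integral>\<^sup>+w. indicator (?I n) w * ?e n w \<partial>M) = (\<integral>\<^sup>+w. indicator (?I n) w * ennreal (g n w) \<partial>M)"
      using IF by (intro nn_cond_exp_intg) auto
    also have "\<dots> = (\<integral>\<^sup>+w. ennreal (indicator (?I n) w * g n w) \<partial>M)"
      by (intro nn_integral_cong) (auto simp: indicator_def)
    finally show ?thesis .
  qed
  have le': "(\<Sum>n<m. \<integral>\<^sup>+w. ennreal (indicator (?I n) w * g n w) \<partial>M) \<le> ennreal c" for m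
    using le[of m] by (subst (asm) nn_integral_sum) (auto simp: eq)
  show int: "integrable M (\<lambda>w. indicator (?I n) w * g n w)" for n
  proof (rule integrableI_nonneg)
    have "(\<integral>\<^sup>+w. ennreal (indicator (?I n) w * g n w) \<partial>M) \<le> (\<Sum>n<Suc n. \<integral>\<^sup>+w. ennreal (indicator (?I n) w * g n w) \<partial>M)"
      by simp
    also have "\<dots> \<le> ennreal c" by (rule le')
    finally show "(\<integral>\<^sup>+w. ennreal (indicator (?I n) w * g n w) \<partial>M) < \<infinity>"
      using le_less_trans by force
  qed (use nonneg in auto)
  have "(\<Sum>n<m. \<integral>w. indicator (?I n) w * g n w \<partial>M) \<le> c" for m
  proof -
    have nn: "0 \<le> (\<integral>w. indicator (?I n) w * g n w \<partial>M)" for n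
      using nonneg by (intro Bochner_Integration.integral_nonneg) auto
    have "ennreal (\<Sum>n<m. \<integral>w. indicator (?I n) w * g n w \<partial>M)
        = (\<Sum>n<m. \<integral>\<^sup>+w. ennreal (indicator (?I n) w * g n w) \<partial>M)"
      unfolding sum_ennreal[OF nn, symmetric] using nonneg
      by (intro sum.cong refl nn_integral_eq_integral[symmetric] int AE_I2) auto
    then have "ennreal (\<Sum>n<m. \<integral>w. indicator (?I n) w * g n w \<partial>M) \<le> ennreal c"
      using le'[of m] by metis
    then show ?thesis unfolding ennreal_le_iff[OF \<open>0 \<le> c\<close>] .
  qed
  then show "summable (\<lambda>n. \<integral>w. indicator (?I n) w * g n w \<partial>M)"
    using nonneg by (intro summableI_nonneg_bounded Bochner_Integration.integral_nonneg) auto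
qed

text \<open>Pettis's measurability theorem in the separable inner product setting: closed balls are
  countable intersections of weakly defined sets, and open sets are countable unions of
  balls.\<close>

lemma borel_measurable_weakly:
  fixes f :: "'w \<Rightarrow> 'a::{real_inner, second_countable_topology}"
  assumes weak [measurable]: "\<And>v. (\<lambda>w. inner (f w) v) \<in> borel_measurable M"
  shows "f \<in> borel_measurable M"
proof -
  obtain D :: "'a set" where "countable D" and D: "\<And>X. open X \<Longrightarrow> X \<noteq> {} \<Longrightarrow> \<exists>d\<in>D. d \<in> X"
    by (erule countable_dense_setE)
  \<comment> \<open>|u|^2 is the supremum of 2 <u, v> - |v|^2, attained at v = u. By continuity v
    may be restricted to \<open>D\<close>, with no need for a dense subset of the unit
    sphere.\<close>
  have norm_le: "norm u \<le> r \<longleftrightarrow> (\<forall>v\<in>D. 2 * inner u v - (norm v)\<^sup>2 \<le> r\<^sup>2)" if "r \<ge> 0" for u :: 'a and r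
  proof
    assume "norm u \<le> r"
    then have "(norm u)\<^sup>2 \<le> r\<^sup>2" by (intro power_mono) auto
    moreover have "2 * inner u v - (norm v)\<^sup>2 \<le> (norm u)\<^sup>2" for v
      using zero_le_power2[of "norm (u - v)"]
      by (simp only: power2_norm_eq_inner) (simp add: inner_simps inner_commute)
    ultimately show "\<forall>v\<in>D. 2 * inner u v - (norm v)\<^sup>2 \<le> r\<^sup>2" by (meson order_trans)
  next
    assume *: "\<forall>v\<in>D. 2 * inner u v - (norm v)\<^sup>2 \<le> r\<^sup>2"
    have "open {v. r\<^sup>2 < 2 * inner u v - (norm v)\<^sup>2}"
      by (intro open_Collect_less continuous_intros)
    with D[of "{v. r\<^sup>2 < 2 * inner u v - (norm v)\<^sup>2}"] * have "u \<notin> {v. r\<^sup>2 < 2 * inner u v - (norm v)\<^sup>2}"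
      by (metis (mono_tags, lifting) empty_iff mem_Collect_eq not_less)
    then have "(norm u)\<^sup>2 \<le> r\<^sup>2" by (simp add: power2_norm_eq_inner)
    then show "norm u \<le> r" using that by (rule power2_le_imp_le)
  qed
  have ball_meas: "{w \<in> space M. f w \<in> cball d r} \<in> sets M" if "r \<ge> 0" for d r
  proof -
    have "{w \<in> space M. \<forall>v\<in>D. 2 * (inner (f w) v - inner d v) - (norm v)\<^sup>2 \<le> r\<^sup>2} \<in> sets M"
      using \<open>countable D\<close> by measurable
    moreover have "f w \<in> cball d r \<longleftrightarrow> (\<forall>v\<in>D. 2 * (inner (f w) v - inner d v) - (norm v)\<^sup>2 \<le> r\<^sup>2)" for w
      using norm_le[OF that, of "f w - d"] by (simp add: dist_norm norm_minus_commute inner_diff_left)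
    ultimately show ?thesis by simp
  qed
  show ?thesis
  proof (rule borel_measurableI)
    fix X :: "'a set" assume "open X"
    define J where "J = {(d, q) \<in> D \<times> {q \<in> \<rat>. 0 < q}. cball d q \<subseteq> X}"
    have "countable J"
      by (rule countable_subset[of _ "D \<times> \<rat>"]) (auto simp: J_def \<open>countable D\<close> countable_rat)
    have X_eq: "X = (\<Union>p\<in>J. cball (fst p) (snd p))"
    proof
      show "X \<subseteq> (\<Union>p\<in>J. cball (fst p) (snd p))"
      proof
        fix u assume "u \<in> X"
        then obtain e where e: "e > 0" "ball u e \<subseteq> X" using \<open>open X\<close> openE by blast
        obtain q where q: "q \<in> \<rat>" "0 < q" "q < e / 2" using Rats_dense_in_real[of 0 "e / 2"] e by auto
        obtain d where d: "d \<in> D" "dist u d < q" using D[of "ball u q"] q by auto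
        have "cball d q \<subseteq> ball u e"
        proof
          fix v assume "v \<in> cball d q"
          then show "v \<in> ball u e" using dist_triangle[of u v d] d q by simp
        qed
        with d q e have "(d, q) \<in> J" "u \<in> cball d q" by (auto simp: J_def dist_commute)
        then show "u \<in> (\<Union>p\<in>J. cball (fst p) (snd p))" by force
      qed
    qed (auto simp: J_def)
    have "f -` X \<inter> space M = (\<Union>p\<in>J. {w \<in> space M. f w \<in> cball (fst p) (snd p)})"
      by (subst X_eq) blast
    also have "\<dots> \<in> sets M"
      using \<open>countable J\<close> by (intro sets.countable_UN'' ball_meas) (auto simp: J_def)
    finally show "f -` X \<inter> space M \<in> sets M" .
  qed
qed

section \<open>The iteration\<close>

text \<open>The dense points must lie in \<open>S\<close> itself, since the descent inequality is
  available only at zeros.\<close>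

lemma ex_countable_dense_subset:
  fixes S :: "'a::second_countable_topology set"
  obtains T where "countable T" "T \<subseteq> S" "S \<subseteq> closure T"
proof -
  obtain \<B> :: "'a set set" where \<B>: "countable \<B>" "topological_basis \<B>"
    using ex_countable_basis by blast
  let ?\<C> = "{b \<in> \<B>. b \<inter> S \<noteq> {}}"
  define f where "f b = (SOME x. x \<in> b \<inter> S)" for b
  have f: "f b \<in> b \<inter> S" if "b \<in> ?\<C>" for b
    unfolding f_def some_in_eq using that by simp
  have "S \<subseteq> closure (f ` ?\<C>)"
  proof
    fix x assume "x \<in> S"
    show "x \<in> closure (f ` ?\<C>)"
      unfolding closure_iff_nhds_not_empty
    proof (intro allI impI)
      fix X U assume U: "U \<subseteq> X" "open U" "x \<in> U"
      obtain b where b: "b \<in> \<B>" "x \<in> b" "b \<subseteq> U" using topological_basisE[OF \<B>(2) U(2,3)] .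
      with \<open>x \<in> S\<close> have "b \<in> ?\<C>" by blast
      with f[OF this] b U show "f ` ?\<C> \<inter> X \<noteq> {}" by blast
    qed
  qed
  moreover have "countable (f ` ?\<C>)" "f ` ?\<C> \<subseteq> S" using \<B>(1) f by auto
  ultimately show ?thesis using that by blast
qed

text \<open>A crude bound that serves integrability. The 9 collects 4 from the cross term, 4 from
  the second difference and 1 from 1 + sqrt 2; the 3 comes from squaring a sum of three
  norms.\<close>

lemma lyapunov_le:
  assumes B: "\<mu>-lipschitz_on UNIV B" and "\<mu> > 0" and "\<gamma> > 0"
  shows "lyapunov B \<mu> a \<gamma> p q x
    \<le> 3 * (2 / \<gamma> + \<mu> * (9 + sqrt 2)) * ((norm (p - a))\<^sup>2 + (norm (q - a))\<^sup>2 + (norm (x - a))\<^sup>2)"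
proof -
  define P Q X s where "P = norm (p - a)" and "Q = norm (q - a)" and "X = norm (x - a)" and "s = P + Q + X"
  have nn: "0 \<le> P" "0 \<le> Q" "0 \<le> X" "0 \<le> s" by (auto simp: P_def Q_def X_def s_def)
  have "norm (B (2 *\<^sub>R q - p) - B a) \<le> \<mu> * norm (2 *\<^sub>R q - p - a)"
    using lipschitz_onD[OF B, of "2 *\<^sub>R q - p" a] by (simp add: dist_norm)
  also have "2 *\<^sub>R q - p - a = 2 *\<^sub>R (q - a) - (p - a)" by (simp add: algebra_simps scaleR_2)
  also have "norm (2 *\<^sub>R (q - a) - (p - a)) \<le> 2 * s"
  proof -
    have "norm (2 *\<^sub>R (q - a) - (p - a)) \<le> 2 * Q + P"
      using norm_triangle_ineq4[of "2 *\<^sub>R (q - a)" "p - a"] by (simp add: P_def Q_def)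
    also have "\<dots> \<le> 2 * s" using nn by (simp add: s_def)
    finally show ?thesis .
  qed
  finally have b: "norm (B (2 *\<^sub>R q - p) - B a) \<le> \<mu> * (2 * s)"
    using \<open>\<mu> > 0\<close> by simp
  have d: "norm (x - q) \<le> s"
    using norm_triangle_ineq4[of "x - a" "q - a"] nn(1) by (simp add: s_def X_def Q_def)
  have "norm (q - p) \<le> s"
    using norm_triangle_ineq4[of "q - a" "p - a"] nn(3) by (simp add: s_def P_def Q_def)
  then have dd: "norm ((x - q) - (q - p)) \<le> 2 * s"
    using d norm_triangle_ineq4[of "x - q" "q - p"] by linarith
  have "inner (B (2 *\<^sub>R q - p) - B a) (x - q) \<le> norm (B (2 *\<^sub>R q - p) - B a) * norm (x - q)"
    by (rule norm_cauchy_schwarz)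
  also have "\<dots> \<le> (\<mu> * (2 * s)) * s"
    using b d nn \<open>\<mu> > 0\<close> by (intro mult_mono) auto
  finally have 1: "2 * inner (B (2 *\<^sub>R q - p) - B a) (x - q) \<le> 4 * \<mu> * s\<^sup>2"
    by (simp add: power2_eq_square)
  have 2: "X\<^sup>2 / \<gamma> \<le> s\<^sup>2 / \<gamma>"
    using nn \<open>\<gamma> > 0\<close> by (intro divide_right_mono power_mono) (auto simp: s_def)
  have 3: "(1 / \<gamma> + \<mu> * (1 + sqrt 2)) * (norm (x - q))\<^sup>2 \<le> (1 / \<gamma> + \<mu> * (1 + sqrt 2)) * s\<^sup>2"
    using d \<open>\<gamma> > 0\<close> \<open>\<mu> > 0\<close> by (intro mult_left_mono power_mono) (auto intro!: add_nonneg_nonneg)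
  have "\<mu> * (norm ((x - q) - (q - p)))\<^sup>2 \<le> \<mu> * (2 * s)\<^sup>2"
    using dd \<open>\<mu> > 0\<close> by (intro mult_left_mono power_mono) auto
  with 1 2 3 have "lyapunov B \<mu> a \<gamma> p q x \<le> (2 / \<gamma> + \<mu> * (9 + sqrt 2)) * s\<^sup>2"
    unfolding lyapunov_def X_def[symmetric] by (simp add: algebra_simps add_divide_distrib power_mult_distrib)
  also have "\<dots> \<le> (2 / \<gamma> + \<mu> * (9 + sqrt 2)) * (3 * (P\<^sup>2 + Q\<^sup>2 + X\<^sup>2))"
  proof (rule mult_left_mono)
    show "s\<^sup>2 \<le> 3 * (P\<^sup>2 + Q\<^sup>2 + X\<^sup>2)"
      using two_mult_le_squares[of P Q] two_mult_le_squares[of P X] two_mult_le_squares[of Q X]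
      by (simp add: s_def power2_eq_square algebra_simps)
    show "0 \<le> 2 / \<gamma> + \<mu> * (9 + sqrt 2)" using \<open>\<gamma> > 0\<close> \<open>\<mu> > 0\<close> by (intro add_nonneg_nonneg) auto
  qed
  finally show ?thesis 
    unfolding P_def Q_def X_def by (simp only: mult.assoc mult.commute mult.left_commute)
qed

text \<open>When the increments vanish, only |x - a|^2 / \<gamma> survives in the limit. The step
  sizes converge to a positive limit, being nondecreasing and bounded by 1 / \<mu>.\<close>

lemma norm_convergent_of_lyapunov:
  fixes X :: "nat \<Rightarrow> 'a::real_inner"
  assumes B: "\<mu>-lipschitz_on UNIV B" and "\<mu> > 0"
    and \<gamma>: "\<And>n. 0 < \<gamma> n" "\<And>n. \<mu> * (1 + sqrt 2) \<le> 1 / \<gamma> n" "mono \<gamma>"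
    and V: "convergent (\<lambda>n. lyapunov B \<mu> a (\<gamma> (Suc n)) (X n) (X (Suc n)) (X (Suc (Suc n))))"
    and d: "(\<lambda>n. X (Suc n) - X n) \<longlonglongrightarrow> 0"
  shows "convergent (\<lambda>n. norm (X n - a))"
proof -
  define V where "V n = lyapunov B \<mu> a (\<gamma> (Suc n)) (X n) (X (Suc n)) (X (Suc (Suc n)))" for n
  define D where "D n = X (Suc n) - X n" for n
  define b where "b n = B (2 *\<^sub>R X (Suc n) - X n) - B a" for n
  have D: "D \<longlonglongrightarrow> 0" using d by (simp add: D_def[abs_def])
  have D': "(\<lambda>n. D (Suc n)) \<longlonglongrightarrow> 0" using D by (rule filterlim_compose) (rule filterlim_Suc)
  have "\<gamma> n \<le> 1 / \<mu>" for n
  proof -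
    have "\<mu> * 1 \<le> \<mu> * (1 + sqrt 2)" using \<open>\<mu> > 0\<close> by (intro mult_left_mono) auto
    then have "\<mu> \<le> 1 / \<gamma> n" using \<gamma>(2)[of n] by simp
    then show ?thesis using \<gamma>(1)[of n] \<open>\<mu> > 0\<close> by (simp add: field_simps)
  qed
  then obtain G where G: "\<gamma> \<longlonglongrightarrow> G" "\<And>n. \<gamma> n \<le> G"
    using incseq_convergent[of \<gamma> "1 / \<mu>"] \<gamma>(3) by blast
  have "G > 0" using G(2)[of 0] \<gamma>(1)[of 0] by simp
  have G': "(\<lambda>n. \<gamma> (Suc n)) \<longlonglongrightarrow> G" using G(1) by (simp add: filterlim_sequentially_Suc)
  obtain K where K: "\<And>n. norm (V n) \<le> K"
    using convergent_imp_Bseq[OF V] unfolding Bseq_def V_def[symmetric] by blast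
  obtain K' where K': "\<And>n. norm (D n) \<le> K'"
    using convergent_imp_Bseq[OF convergentI[OF D]] unfolding Bseq_def by blast
  \<comment> \<open>The lower bound on the Lyapunov function makes the iterates bounded, hence
    \<open>b\<close> bounded, without which the cross term could not be dismissed.\<close>
  have Xbd: "norm (X (Suc (Suc n)) - a) \<le> sqrt (K / \<mu>)" for n
  proof (rule real_le_rsqrt)
    have "\<mu> * (norm (X (Suc (Suc n)) - a))\<^sup>2 \<le> V n"
      unfolding V_def by (rule lyapunov_ge[OF B \<open>\<mu> > 0\<close> \<gamma>(2)])
    also have "\<dots> \<le> K" using K[of n] by simp
    finally show "(norm (X (Suc (Suc n)) - a))\<^sup>2 \<le> K / \<mu>"
      using \<open>\<mu> > 0\<close> by (simp add: pos_le_divide_eq mult.commute)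
  qed
  have b_bd: "norm (b n) \<le> \<mu> * (sqrt (K / \<mu>) + 2 * K')" for n
  proof -
    have "norm (b n) \<le> \<mu> * norm (2 *\<^sub>R X (Suc n) - X n - a)"
      using lipschitz_onD[OF B, of "2 *\<^sub>R X (Suc n) - X n" a] by (simp add: dist_norm b_def)
    also have "2 *\<^sub>R X (Suc n) - X n - a = (X (Suc (Suc n)) - a) - (D (Suc n) - D n)"
      by (simp add: D_def scaleR_2)
    also have "\<mu> * norm \<dots> \<le> \<mu> * (sqrt (K / \<mu>) + 2 * K')"
    proof (rule mult_left_mono)
      show "norm (X (Suc (Suc n)) - a - (D (Suc n) - D n)) \<le> sqrt (K / \<mu>) + 2 * K'"
        using norm_triangle_ineq4[of "X (Suc (Suc n)) - a" "D (Suc n) - D n"]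
          norm_triangle_ineq4[of "D (Suc n)" "D n"] Xbd[of n] K'[of n] K'[of "Suc n"] by linarith
    qed (use \<open>\<mu> > 0\<close> in simp)
    finally show ?thesis .
  qed
  have "(\<lambda>n. inner (b n) (D (Suc n))) \<longlonglongrightarrow> 0"
  proof (rule Lim_null_comparison)
    have "norm (inner (b n) (D (Suc n))) \<le> \<mu> * (sqrt (K / \<mu>) + 2 * K') * norm (D (Suc n))" for n
      using Cauchy_Schwarz_ineq2[of "b n" "D (Suc n)"] mult_right_mono[OF b_bd[of n] norm_ge_zero[of "D (Suc n)"]] by simp
    then show "\<forall>\<^sub>F n in sequentially. norm (inner (b n) (D (Suc n))) \<le> \<mu> * (sqrt (K / \<mu>) + 2 * K') * norm (D (Suc n))"
      by simp
    show "(\<lambda>n. \<mu> * (sqrt (K / \<mu>) + 2 * K') * norm (D (Suc n))) \<longlonglongrightarrow> 0"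
      by (rule tendsto_mult_right_zero[OF tendsto_norm_zero[OF D']])
  qed
  then have "(\<lambda>n. \<gamma> (Suc n) * (V n - (2 * inner (b n) (D (Suc n))
      + (1 / \<gamma> (Suc n) + \<mu> * (1 + sqrt 2)) * (norm (D (Suc n)))\<^sup>2 + \<mu> * (norm (D (Suc n) - D n))\<^sup>2)))
    \<longlonglongrightarrow> G * (lim V - (2 * 0 + (1 / G + \<mu> * (1 + sqrt 2)) * (norm (0::'a))\<^sup>2 + \<mu> * (norm (0 - 0::'a))\<^sup>2))"
    using V \<open>G > 0\<close> unfolding V_def[symmetric] convergent_LIMSEQ_iff by (intro tendsto_intros G' D D') auto
  moreover have "\<gamma> (Suc n) * (V n - (2 * inner (b n) (D (Suc n))
      + (1 / \<gamma> (Suc n) + \<mu> * (1 + sqrt 2)) * (norm (D (Suc n)))\<^sup>2 + \<mu> * (norm (D (Suc n) - D n))\<^sup>2))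
    = (norm (X (Suc (Suc n)) - a))\<^sup>2" for n
    using \<gamma>(1)[of "Suc n"] by (simp add: V_def lyapunov_def b_def D_def)
  ultimately have "(\<lambda>n. sqrt ((norm (X (Suc (Suc n)) - a))\<^sup>2)) \<longlonglongrightarrow> sqrt (G * lim V)"
    by (intro tendsto_intros) simp
  then show ?thesis
    by (subst convergent_Suc_iff[symmetric], subst convergent_Suc_iff[symmetric]) (auto simp: convergent_def)
qed

section \<open>The natural filtration and the iteration as a locale\<close>

lemma sets_nat_filtration:
  "sets (nat_filtration M x n) = sigma_sets (space M) (\<Union>i\<in>{..n}. {x i -` S \<inter> space M | S. S \<in> sets borel})"
  unfolding nat_filtration_def by (rule sets_measure_of) auto

lemma space_nat_filtration: "space (nat_filtration M x n) = space M"
  unfolding nat_filtration_def by (rule space_measure_of) auto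

lemma subalgebra_nat_filtration:
  assumes "\<And>n. x n \<in> borel_measurable M"
  shows "subalgebra M (nat_filtration M x n)"
  unfolding subalgebra_def space_nat_filtration sets_nat_filtration
  using measurable_sets[OF assms] by (auto intro!: sets.sigma_sets_subset)

lemma subalgebra_nat_filtration_mono:
  assumes "m \<le> n"
  shows "subalgebra (nat_filtration M x n) (nat_filtration M x m)"
  unfolding subalgebra_def space_nat_filtration sets_nat_filtration
  using assms by (intro conjI refl sigma_sets_mono' UN_mono) auto

lemma measurable_nat_filtration:
  fixes x :: "nat \<Rightarrow> 'w \<Rightarrow> 'a::topological_space"
  assumes "m \<le> n"
  shows "x m \<in> borel_measurable (nat_filtration M x n)"
proof (rule measurableI)
  fix S :: "'a set" assume "S \<in> sets borel"
  then show "x m -` S \<inter> space (nat_filtration M x n) \<in> sets (nat_filtration M x n)"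
    unfolding space_nat_filtration sets_nat_filtration using assms by (intro sigma_sets.Basic) blast
qed simp

locale reflected_stochastic_fb = prob_space M for M :: "'w measure" +
  fixes A :: "'a::{real_inner, banach, second_countable_topology} \<Rightarrow> 'a set"
    and B :: "'a \<Rightarrow> 'a" and \<mu> \<tau> :: real and \<gamma> :: "nat \<Rightarrow> real"
    and x :: "nat \<Rightarrow> 'w \<Rightarrow> 'a" and xm1 :: "'w \<Rightarrow> 'a" and r y :: "nat \<Rightarrow> 'w \<Rightarrow> 'a"
  assumes A: "maximally_monotone A" and Bmono: "monotone_fun B"
    and \<mu>pos: "\<mu> > 0" and Blip: "\<mu>-lipschitz_on UNIV B"
    and \<gamma>range: "\<And>n. \<gamma> n \<in> {0<..<(sqrt 2 - 1) / \<mu>}" and \<gamma>mono: "mono \<gamma>"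
    and \<tau>pos: "\<tau> > 0" and \<tau>le: "\<And>n. \<tau> \<le> 2 / \<gamma> (Suc n) - 1 / \<gamma> n - \<mu> * (1 + sqrt 2)"
    and x0: "x 0 \<in> borel_measurable M" "integrable M (\<lambda>w. (norm (x 0 w))\<^sup>2)"
    and xm1: "xm1 \<in> borel_measurable M" "integrable M (\<lambda>w. (norm (xm1 w))\<^sup>2)"
    and y0: "\<And>w. y 0 w = 2 *\<^sub>R x 0 w - xm1 w"
    and y_Suc: "\<And>n w. y (Suc n) w = 2 *\<^sub>R x (Suc n) w - x n w"
    and r_meas: "\<And>n. r n \<in> borel_measurable M"
    and r_ce: "\<And>n. is_cond_exp M (nat_filtration M x n) (r n) (\<lambda>w. B (y n w))"
    and iter: "\<And>n w. w \<in> space M \<Longrightarrow> x (Suc n) w = resolvent (\<gamma> n) A (x n w - \<gamma> n *\<^sub>R r n w)"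
    and noise: "AE w in M. (\<Sum>n. nn_cond_exp M (nat_filtration M x n)
                   (\<lambda>w. ennreal ((norm (r n w - B (y n w)))\<^sup>2)) w) < \<infinity>"
begin

abbreviation "F \<equiv> nat_filtration M x"

definition "err n w = r n w - B (y n w)"

definition "I c n = cond_exp_sublevel M F (\<lambda>n w. (norm (err n w))\<^sup>2) c n"

lemma Amono: "monotone_op A"
  using A by (simp add: maximally_monotone_def)

lemma \<gamma>pos: "\<gamma> n > 0"
  using \<gamma>range by simp

lemma inverse_\<gamma>_ge: "\<mu> * (1 + sqrt 2) \<le> 1 / \<gamma> n"
  by (rule inverse_step_ge[OF \<mu>pos \<gamma>range])

lemma \<gamma>\<mu>_le: "\<gamma> n * \<mu> \<le> 1"
proof -
  have "\<mu> * 1 \<le> \<mu> * (1 + sqrt 2)" using \<mu>pos by (intro mult_left_mono) auto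
  then have "\<mu> \<le> 1 / \<gamma> n" using inverse_\<gamma>_ge[of n] by simp
  then show ?thesis using \<gamma>pos[of n] by (simp add: field_simps)
qed

lemma x_meas [measurable]: "x n \<in> borel_measurable M"
proof (induction n)
  case (Suc n)
  note [measurable] = Suc r_meas
  have "resolvent (\<gamma> n) A \<in> borel_measurable borel"
    by (intro borel_measurable_continuous_onI continuous_on_resolvent A \<gamma>pos)
  then have "(\<lambda>w. resolvent (\<gamma> n) A (x n w - \<gamma> n *\<^sub>R r n w)) \<in> borel_measurable M"
    by measurable
  then show ?case using iter by (simp cong: measurable_cong)
qed (rule x0)

lemma x_adapted: "m \<le> n \<Longrightarrow> x m \<in> borel_measurable (F n)"
  by (rule measurable_nat_filtration)

lemma subM: "subalgebra M (F n)"
  by (rule subalgebra_nat_filtration[OF x_meas])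

lemma subF: "m \<le> n \<Longrightarrow> subalgebra (F n) (F m)"
  by (rule subalgebra_nat_filtration_mono)

lemma B_meas [measurable]: "B \<in> borel_measurable borel"
  by (intro borel_measurable_continuous_onI lipschitz_on_continuous_on[OF Blip])

lemma y_meas [measurable]: "y n \<in> borel_measurable M"
proof (cases n)
  case 0
  have "y 0 = (\<lambda>w. 2 *\<^sub>R x 0 w - xm1 w)" using y0 by auto
  then show ?thesis using xm1(1) 0 by simp
next
  case (Suc k)
  have "y (Suc k) = (\<lambda>w. 2 *\<^sub>R x (Suc k) w - x k w)" using y_Suc by auto
  then show ?thesis using Suc by simp
qed

lemma err_meas [measurable]: "err n \<in> borel_measurable M"
  unfolding err_def[abs_def] using r_meas by measurable

lemma err_integrable: "integrable M (err n)"
  using r_ce[of n] unfolding err_def[abs_def] is_cond_exp_def by auto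

lemma err_mean_zero:
  assumes "S \<in> sets (F n)"
  shows "(LINT w:S|M. err n w) = 0"
proof -
  have S: "S \<in> sets M" using assms subM[of n] by (auto simp: subalgebra_def)
  have "integrable M (r n)" "integrable M (\<lambda>w. B (y n w))" "(LINT w:S|M. r n w) = (LINT w:S|M. B (y n w))"
    using r_ce[of n] assms by (auto simp: is_cond_exp_def)
  then show ?thesis
    unfolding err_def
    by (subst set_integral_diff) (auto simp: set_integrable_def intro: integrable_mult_indicator S)
qed

lemma I_F: "I c n \<in> sets (F n)"
  unfolding I_def by (rule cond_exp_sublevel_sets[OF subF space_nat_filtration])

lemma I_M [measurable]: "I c n \<in> sets M"
  using I_F[of c n] subM[of n] by (auto simp: subalgebra_def)

lemma I_antimono: "m \<le> n \<Longrightarrow> I c n \<subseteq> I c m"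
  unfolding I_def by (rule cond_exp_sublevel_antimono)

lemma I_err:
  assumes "0 \<le> c"
  shows "integrable M (\<lambda>w. indicator (I c n) w * (norm (err n w))\<^sup>2)"
    and "summable (\<lambda>n. \<integral>w. indicator (I c n) w * (norm (err n w))\<^sup>2 \<partial>M)"
proof -
  have "(\<lambda>w. (norm (err n w))\<^sup>2) \<in> borel_measurable M" for n by measurable
  note * = cond_exp_sublevel_summable[of M F "\<lambda>n w. (norm (err n w))\<^sup>2" c,
      OF prob_space_axioms subM subF this _ assms]
  show "integrable M (\<lambda>w. indicator (I c n) w * (norm (err n w))\<^sup>2)"
    unfolding I_def by (rule *(1)) simp_all
  show "summable (\<lambda>n. \<integral>w. indicator (I c n) w * (norm (err n w))\<^sup>2 \<partial>M)"
    unfolding I_def by (rule *(2)) simp_all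
qed

lemma AE_I: "AE w in M. \<exists>c::nat. \<forall>n. w \<in> I (real c) n"
  using noise AE_space
proof eventually_elim
  case (elim w)
  then show ?case unfolding I_def
    using cond_exp_sublevel_exhausts[of w M F "\<lambda>n w. (norm (err n w))\<^sup>2"]
    by (simp add: err_def) blast
qed

lemma integrable_indicator_antimono:
  fixes f :: "'w \<Rightarrow> real"
  assumes "integrable M (\<lambda>w. indicator (I c m) w * f w)" "m \<le> n"
  shows "integrable M (\<lambda>w. indicator (I c n) w * f w)"
proof -
  have "integrable M (\<lambda>w. indicator (I c n) w *\<^sub>R (indicator (I c m) w * f w))"
    by (rule integrable_mult_indicator[OF I_M assms(1)])
  moreover have eq: "indicator (I c n) w *\<^sub>R (indicator (I c m) w * f w) = indicator (I c n) w * f w" for w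
    using I_antimono[OF assms(2), of c] by (auto simp: indicator_def)
  ultimately show ?thesis unfolding eq by blast
qed

lemma step_mem:
  assumes "w \<in> space M"
  shows "(1 / \<gamma> n) *\<^sub>R (x n w - \<gamma> n *\<^sub>R (B (y n w) + err n w) - x (Suc n) w) \<in> A (x (Suc n) w)"
  using resolvent_mem[OF A \<gamma>pos, of n "x n w - \<gamma> n *\<^sub>R r n w"] iter[OF assms] by (simp add: err_def)

section \<open>Convergence relative to one fixed zero\<close>

context
  fixes a assumes a: "- B a \<in> A a"
begin

text \<open>The zero a is the resolvent of a - \<gamma> B a, so nonexpansiveness compares both
  points. The squared form carries square integrability from one iterate to the next.\<close>

lemma norm_step_le:
  assumes "w \<in> space M"
  shows "norm (x (Suc n) w - a) \<le> norm (x n w - a) + norm (y n w - a) + norm (err n w) / \<mu>"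
proof -
  have "norm (x (Suc n) w - a) \<le> norm ((x (Suc n) w + \<gamma> n *\<^sub>R ((1 / \<gamma> n) *\<^sub>R (x n w - \<gamma> n *\<^sub>R (B (y n w) + err n w) - x (Suc n) w)))
      - (a + \<gamma> n *\<^sub>R (- B a)))"
    by (rule monotone_op_nonexpansive[OF Amono \<gamma>pos step_mem[OF assms] a])
  also have "(x (Suc n) w + \<gamma> n *\<^sub>R ((1 / \<gamma> n) *\<^sub>R (x n w - \<gamma> n *\<^sub>R (B (y n w) + err n w) - x (Suc n) w)))
      - (a + \<gamma> n *\<^sub>R (- B a)) = (x n w - a) - \<gamma> n *\<^sub>R (B (y n w) - B a) - \<gamma> n *\<^sub>R err n w"
    using \<gamma>pos[of n] by (simp add: algebra_simps)
  also have "norm \<dots> \<le> norm (x n w - a) + \<gamma> n * norm (B (y n w) - B a) + \<gamma> n * norm (err n w)"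
    using norm_triangle_ineq4[of "(x n w - a) - \<gamma> n *\<^sub>R (B (y n w) - B a)" "\<gamma> n *\<^sub>R err n w"]
      norm_triangle_ineq4[of "x n w - a" "\<gamma> n *\<^sub>R (B (y n w) - B a)"] \<gamma>pos[of n] by simp
  also have "\<dots> \<le> norm (x n w - a) + norm (y n w - a) + norm (err n w) / \<mu>"
  proof (intro add_mono order_refl)
    have "\<gamma> n * norm (B (y n w) - B a) \<le> \<gamma> n * (\<mu> * norm (y n w - a))"
      using lipschitz_onD[OF Blip, of "y n w" a] \<gamma>pos[of n] by (intro mult_left_mono) (auto simp: dist_norm)
    also have "\<dots> \<le> 1 * norm (y n w - a)"
      unfolding mult.assoc[symmetric] by (intro mult_right_mono \<gamma>\<mu>_le) auto
    finally show "\<gamma> n * norm (B (y n w) - B a) \<le> norm (y n w - a)" by simp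
    have "\<gamma> n \<le> 1 / \<mu>" using \<gamma>\<mu>_le[of n] \<mu>pos by (simp add: pos_le_divide_eq)
    then show "\<gamma> n * norm (err n w) \<le> norm (err n w) / \<mu>"
      using mult_right_mono[of "\<gamma> n" "1 / \<mu>" "norm (err n w)"] by simp
  qed
  finally show ?thesis .
qed

lemma norm_square_step_le:
  assumes "w \<in> space M"
  shows "(norm (x (Suc n) w - a))\<^sup>2
    \<le> 3 * ((norm (x n w - a))\<^sup>2 + (norm (y n w - a))\<^sup>2 + (norm (err n w))\<^sup>2 / \<mu>\<^sup>2)"
proof -
  define p q s where "p = norm (x n w - a)" and "q = norm (y n w - a)" and "s = norm (err n w) / \<mu>"
  have "(norm (x (Suc n) w - a))\<^sup>2 \<le> (p + q + s)\<^sup>2"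
    unfolding p_def q_def s_def by (intro power_mono norm_step_le[OF assms]) auto
  also have "\<dots> \<le> 3 * (p\<^sup>2 + q\<^sup>2 + s\<^sup>2)"
    using two_mult_le_squares[of p q] two_mult_le_squares[of p s] two_mult_le_squares[of q s]
    by (simp add: power2_eq_square algebra_simps)
  finally show ?thesis by (simp add: p_def q_def s_def power_divide)
qed

lemma norm_square_reflected_le:
  fixes u v :: 'a
  shows "(norm (2 *\<^sub>R u - v - a))\<^sup>2 \<le> 8 * (norm (u - a))\<^sup>2 + 2 * (norm (v - a))\<^sup>2"
proof -
  have eq: "2 *\<^sub>R u - v - a = 2 *\<^sub>R (u - a) - (v - a)" by (simp add: algebra_simps scaleR_2)
  have "(norm (2 *\<^sub>R u - v - a))\<^sup>2 \<le> (2 * norm (u - a) + norm (v - a))\<^sup>2"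
    unfolding eq using norm_triangle_ineq4[of "2 *\<^sub>R (u - a)" "v - a"] by (intro power_mono) auto
  also have "\<dots> \<le> 8 * (norm (u - a))\<^sup>2 + 2 * (norm (v - a))\<^sup>2"
    using two_mult_le_squares[of "2 * norm (u - a)" "norm (v - a)"]
    by (simp add: power2_sum power_mult_distrib)
  finally show ?thesis .
qed

lemma integrable_norm_square_diff:
  assumes "f \<in> borel_measurable M" "integrable M (\<lambda>w. (norm (f w))\<^sup>2)"
  shows "integrable M (\<lambda>w. (norm (f w - a))\<^sup>2)"
proof (rule Bochner_Integration.integrable_bound)
  show "integrable M (\<lambda>w. 2 * (norm (f w))\<^sup>2 + 2 * (norm a)\<^sup>2)" using assms(2) by simp
  show "AE w in M. norm ((norm (f w - a))\<^sup>2) \<le> norm (2 * (norm (f w))\<^sup>2 + 2 * (norm a)\<^sup>2)"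
  proof (rule AE_I2)
    fix w
    have "(norm (f w - a))\<^sup>2 \<le> (norm (f w) + norm a)\<^sup>2"
      by (intro power_mono norm_triangle_ineq4) auto
    also have "\<dots> \<le> 2 * (norm (f w))\<^sup>2 + 2 * (norm a)\<^sup>2"
      using two_mult_le_squares[of "norm (f w)" "norm a"] by (simp add: power2_sum)
    finally show "norm ((norm (f w - a))\<^sup>2) \<le> norm (2 * (norm (f w))\<^sup>2 + 2 * (norm a)\<^sup>2)" by simp
  qed
qed (use assms(1) in measurable)

lemma localized_step_integrable:
  assumes "0 \<le> c"
    and int: "integrable M (\<lambda>w. indicator (I c n) w * (norm (x n w - a))\<^sup>2)"
      "integrable M (\<lambda>w. indicator (I c n) w * (norm (y n w - a))\<^sup>2)"
  shows "integrable M (\<lambda>w. indicator (I c n) w * (norm (x (Suc n) w - a))\<^sup>2)"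
proof (rule Bochner_Integration.integrable_bound)
  show "integrable M (\<lambda>w. 3 * (indicator (I c n) w * (norm (x n w - a))\<^sup>2
      + indicator (I c n) w * (norm (y n w - a))\<^sup>2 + indicator (I c n) w * (norm (err n w))\<^sup>2 / \<mu>\<^sup>2))"
    using int I_err(1)[OF assms(1), of n] by simp
  show "AE w in M. norm (indicator (I c n) w * (norm (x (Suc n) w - a))\<^sup>2)
    \<le> norm (3 * (indicator (I c n) w * (norm (x n w - a))\<^sup>2
      + indicator (I c n) w * (norm (y n w - a))\<^sup>2 + indicator (I c n) w * (norm (err n w))\<^sup>2 / \<mu>\<^sup>2))"
    using norm_square_step_le by (intro AE_I2) (auto simp: indicator_def)
qed measurable

text \<open>The index may reach Suc n because \<open>I c n\<close> already controls
  \<open>err n\<close>, the error entering x (Suc n).\<close>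

lemma localized_square_integrable:
  assumes "0 \<le> c" "m \<le> Suc n"
  shows "integrable M (\<lambda>w. indicator (I c n) w * (norm (x m w - a))\<^sup>2)"
  using assms(2)
proof (induction n arbitrary: m)
  case 0
  have int_x0: "integrable M (\<lambda>w. indicator (I c 0) w * (norm (x 0 w - a))\<^sup>2)"
    using integrable_mult_indicator[OF I_M[of c 0] integrable_norm_square_diff[OF x0]] by simp
  have int_xm1: "integrable M (\<lambda>w. indicator (I c 0) w * (norm (xm1 w - a))\<^sup>2)"
    using integrable_mult_indicator[OF I_M[of c 0] integrable_norm_square_diff[OF xm1]] by simp
  have "integrable M (\<lambda>w. indicator (I c 0) w * (norm (y 0 w - a))\<^sup>2)"
  proof (rule Bochner_Integration.integrable_bound)
    show "integrable M (\<lambda>w. 8 * (indicator (I c 0) w * (norm (x 0 w - a))\<^sup>2)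
        + 2 * (indicator (I c 0) w * (norm (xm1 w - a))\<^sup>2))"
      using int_x0 int_xm1 by simp
    show "AE w in M. norm (indicator (I c 0) w * (norm (y 0 w - a))\<^sup>2)
      \<le> norm (8 * (indicator (I c 0) w * (norm (x 0 w - a))\<^sup>2) + 2 * (indicator (I c 0) w * (norm (xm1 w - a))\<^sup>2))"
      unfolding y0 using norm_square_reflected_le by (intro AE_I2) (auto simp: indicator_def)
  qed measurable
  with int_x0 have "integrable M (\<lambda>w. indicator (I c 0) w * (norm (x (Suc 0) w - a))\<^sup>2)"
    by (intro localized_step_integrable assms(1))
  with int_x0 0 show ?case by (cases m) auto
next
  case (Suc n)
  have old: "integrable M (\<lambda>w. indicator (I c (Suc n)) w * (norm (x k w - a))\<^sup>2)" if "k \<le> Suc n" for k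
    using Suc.IH[OF that] by (rule integrable_indicator_antimono) simp
  show ?case
  proof (cases "m \<le> Suc n")
    case False
    then have m: "m = Suc (Suc n)" using Suc.prems by simp
    have "integrable M (\<lambda>w. indicator (I c (Suc n)) w * (norm (y (Suc n) w - a))\<^sup>2)"
    proof (rule Bochner_Integration.integrable_bound)
      show "integrable M (\<lambda>w. 8 * (indicator (I c (Suc n)) w * (norm (x (Suc n) w - a))\<^sup>2)
          + 2 * (indicator (I c (Suc n)) w * (norm (x n w - a))\<^sup>2))"
        using old[of "Suc n"] old[of n] by simp
      show "AE w in M. norm (indicator (I c (Suc n)) w * (norm (y (Suc n) w - a))\<^sup>2)
        \<le> norm (8 * (indicator (I c (Suc n)) w * (norm (x (Suc n) w - a))\<^sup>2) + 2 * (indicator (I c (Suc n)) w * (norm (x n w - a))\<^sup>2))"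
        unfolding y_Suc using norm_square_reflected_le by (intro AE_I2) (auto simp: indicator_def)
    qed measurable
    with old[of "Suc n"] show ?thesis
      unfolding m by (intro localized_step_integrable assms(1)) auto
  qed (rule old)
qed

text \<open>The index is shifted by two because \<open>xm1\<close> need not be measurable with respect to \<open>F 0\<close>.\<close>

definition "V n w = lyapunov B \<mu> a (\<gamma> (Suc n)) (x n w) (x (Suc n) w) (x (Suc (Suc n)) w)"

lemma V_adapted: "V n \<in> borel_measurable (F (Suc (Suc n)))"
proof -
  have [measurable]: "x n \<in> borel_measurable (F (Suc (Suc n)))"
    "x (Suc n) \<in> borel_measurable (F (Suc (Suc n)))"
    "x (Suc (Suc n)) \<in> borel_measurable (F (Suc (Suc n)))"
    by (intro x_adapted; simp)+
  show ?thesis unfolding V_def[abs_def] lyapunov_def by measurable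
qed

lemma V_ge: "\<mu> * (norm (x (Suc (Suc n)) w - a))\<^sup>2 \<le> V n w"
  unfolding V_def by (rule lyapunov_ge[OF Blip \<mu>pos inverse_\<gamma>_ge])

lemma V_nonneg: "0 \<le> V n w"
  using V_ge[of n w] \<mu>pos by (meson mult_nonneg_nonneg less_imp_le order_trans zero_le_power2)

lemma V_integrable:
  assumes "0 \<le> c" "Suc n \<le> m"
  shows "integrable M (\<lambda>w. indicator (I c m) w * V n w)"
proof (rule Bochner_Integration.integrable_bound)
  let ?K = "3 * (2 / \<gamma> (Suc n) + \<mu> * (9 + sqrt 2))"
  show "integrable M (\<lambda>w. ?K * (indicator (I c m) w * (norm (x n w - a))\<^sup>2
     + indicator (I c m) w * (norm (x (Suc n) w - a))\<^sup>2 + indicator (I c m) w * (norm (x (Suc (Suc n)) w - a))\<^sup>2))"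
    using assms by (intro integrable_mult_right Bochner_Integration.integrable_add localized_square_integrable) auto
  have [measurable]: "V n \<in> borel_measurable M" by (rule measurable_from_subalg[OF subM V_adapted])
  show "(\<lambda>w. indicator (I c m) w * V n w) \<in> borel_measurable M" by measurable
  show "AE w in M. norm (indicator (I c m) w * V n w) \<le> norm (?K * (indicator (I c m) w * (norm (x n w - a))\<^sup>2
     + indicator (I c m) w * (norm (x (Suc n) w - a))\<^sup>2 + indicator (I c m) w * (norm (x (Suc (Suc n)) w - a))\<^sup>2))"
  proof (rule AE_I2)
    fix w
    have "V n w \<le> ?K * ((norm (x n w - a))\<^sup>2 + (norm (x (Suc n) w - a))\<^sup>2 + (norm (x (Suc (Suc n)) w - a))\<^sup>2)"
      unfolding V_def by (rule lyapunov_le[OF Blip \<mu>pos \<gamma>pos])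
    then show "norm (indicator (I c m) w * V n w) \<le> norm (?K * (indicator (I c m) w * (norm (x n w - a))\<^sup>2
     + indicator (I c m) w * (norm (x (Suc n) w - a))\<^sup>2 + indicator (I c m) w * (norm (x (Suc (Suc n)) w - a))\<^sup>2))"
      using V_nonneg[of n w] by (cases "w \<in> I c m") auto
  qed
qed

lemma V_descent:
  assumes "w \<in> space M"
  shows "V (Suc n) w + \<tau> / 2 * (norm (x (Suc (Suc (Suc n))) w - x (Suc (Suc n)) w))\<^sup>2
    \<le> V n w + 16 / \<tau> * ((norm (err (Suc n) w))\<^sup>2 + (norm (err (Suc (Suc n)) w))\<^sup>2)
      + inner (err (Suc (Suc n)) w) (- 2 *\<^sub>R (x (Suc (Suc n)) w - a))"
  unfolding V_def
proof (rule lyapunov_descent_noise[OF Amono Bmono Blip \<mu>pos a])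
  show "(1 / \<gamma> (Suc n)) *\<^sub>R (x (Suc n) w - \<gamma> (Suc n) *\<^sub>R (B (2 *\<^sub>R x (Suc n) w - x n w) + err (Suc n) w) - x (Suc (Suc n)) w)
      \<in> A (x (Suc (Suc n)) w)"
    using step_mem[OF assms, of "Suc n"] by (simp add: y_Suc)
  show "(1 / \<gamma> (Suc (Suc n))) *\<^sub>R (x (Suc (Suc n)) w - \<gamma> (Suc (Suc n)) *\<^sub>R (B (2 *\<^sub>R x (Suc (Suc n)) w - x (Suc n) w) + err (Suc (Suc n)) w) - x (Suc (Suc (Suc n))) w)
      \<in> A (x (Suc (Suc (Suc n))) w)"
    using step_mem[OF assms, of "Suc (Suc n)"] by (simp add: y_Suc)
  show "\<gamma> (Suc n) \<le> \<gamma> (Suc (Suc n))" using \<gamma>mono by (simp add: monoD)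
qed (rule \<gamma>pos inverse_\<gamma>_ge \<tau>pos \<tau>le)+

lemma localized_convergence:
  assumes "0 \<le> c"
  shows "AE w in M. (\<forall>n. w \<in> I c (Suc (Suc n))) \<longrightarrow>
    convergent (\<lambda>n. V n w) \<and> summable (\<lambda>n. \<tau> / 2 * (norm (x (Suc (Suc (Suc n))) w - x (Suc (Suc n)) w))\<^sup>2)"
proof (rule almost_supermartingale_localized[where F = "\<lambda>n. F (Suc (Suc n))"
      and Z = "\<lambda>n w. 16 / \<tau> * ((norm (err (Suc n) w))\<^sup>2 + (norm (err (Suc (Suc n)) w))\<^sup>2)"
      and N = "\<lambda>n w. inner (err (Suc (Suc n)) w) (- 2 *\<^sub>R (x (Suc (Suc n)) w - a))"])
  show "finite_measure M" by unfold_locales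
  show "subalgebra M (F (Suc (Suc n)))" for n by (rule subM)
  show "subalgebra (F (Suc (Suc (Suc n)))) (F (Suc (Suc n)))" for n by (rule subF) simp
  show "V n \<in> borel_measurable (F (Suc (Suc n)))" for n by (rule V_adapted)
  show "0 \<le> V n w" for n w by (rule V_nonneg)
  show "(\<lambda>w. \<tau> / 2 * (norm (x (Suc (Suc (Suc n))) w - x (Suc (Suc n)) w))\<^sup>2) \<in> borel_measurable M" for n
    by measurable
  show "0 \<le> \<tau> / 2 * (norm (x (Suc (Suc (Suc n))) w - x (Suc (Suc n)) w))\<^sup>2" for n w
    using \<tau>pos by simp
  show "0 \<le> 16 / \<tau> * ((norm (err (Suc n) w))\<^sup>2 + (norm (err (Suc (Suc n)) w))\<^sup>2)" for n w
    using \<tau>pos by simp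
  show "I c (Suc (Suc n)) \<in> sets (F (Suc (Suc n)))" for n by (rule I_F)
  show "I c (Suc (Suc (Suc n))) \<subseteq> I c (Suc (Suc n))" for n by (rule I_antimono) simp
  show "integrable M (\<lambda>w. indicator (I c (Suc (Suc n))) w * V n w)" for n
    using assms by (rule V_integrable) simp
  show "integrable M (\<lambda>w. indicator (I c (Suc (Suc n))) w * V (Suc n) w)" for n
    using assms by (rule V_integrable) simp
  \<comment> \<open>The remainder also contains the previous error, which is controlled on the
    larger event with the previous index.\<close>
  have int_old: "integrable M (\<lambda>w. indicator (I c (Suc (Suc n))) w * (norm (err (Suc n) w))\<^sup>2)" for n
    by (rule integrable_indicator_antimono[OF I_err(1)[OF assms]]) simp
  have Z_eq: "indicator (I c (Suc (Suc n))) w * (16 / \<tau> * ((norm (err (Suc n) w))\<^sup>2 + (norm (err (Suc (Suc n)) w))\<^sup>2))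
    = 16 / \<tau> * (indicator (I c (Suc (Suc n))) w * (norm (err (Suc n) w))\<^sup>2
        + indicator (I c (Suc (Suc n))) w * (norm (err (Suc (Suc n)) w))\<^sup>2)" for n w
    by (simp add: algebra_simps)
  show "integrable M (\<lambda>w. indicator (I c (Suc (Suc n))) w * (16 / \<tau> * ((norm (err (Suc n) w))\<^sup>2 + (norm (err (Suc (Suc n)) w))\<^sup>2)))" for n
    unfolding Z_eq by (intro integrable_mult_right Bochner_Integration.integrable_add int_old I_err(1) assms)
  show "summable (\<lambda>n. \<integral>w. indicator (I c (Suc (Suc n))) w * (16 / \<tau> * ((norm (err (Suc n) w))\<^sup>2 + (norm (err (Suc (Suc n)) w))\<^sup>2)) \<partial>M)"
  proof (rule summable_comparison_test')
    let ?s = "\<lambda>n. \<integral>w. indicator (I c n) w * (norm (err n w))\<^sup>2 \<partial>M"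
    have "summable (\<lambda>n. ?s (Suc n))" "summable (\<lambda>n. ?s (Suc (Suc n)))"
      using I_err(2)[OF assms] summable_Suc_iff[of ?s] summable_Suc_iff[of "\<lambda>n. ?s (Suc n)"] by blast+
    then show "summable (\<lambda>n. 16 / \<tau> * (?s (Suc n) + ?s (Suc (Suc n))))"
      by (intro summable_mult summable_add)
    fix n :: nat
    have "(\<integral>w. indicator (I c (Suc (Suc n))) w * (norm (err (Suc n) w))\<^sup>2 \<partial>M) \<le> ?s (Suc n)"
      using I_antimono[of "Suc n" "Suc (Suc n)" c]
      by (intro integral_mono int_old I_err(1) assms) (auto simp: indicator_def)
    moreover have "0 \<le> (\<integral>w. indicator (I c (Suc (Suc n))) w * (norm (err (Suc n) w))\<^sup>2 \<partial>M)" "0 \<le> ?s (Suc (Suc n))"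
      by (auto intro!: Bochner_Integration.integral_nonneg)
    ultimately show "norm (\<integral>w. indicator (I c (Suc (Suc n))) w * (16 / \<tau> * ((norm (err (Suc n) w))\<^sup>2 + (norm (err (Suc (Suc n)) w))\<^sup>2)) \<partial>M)
      \<le> 16 / \<tau> * (?s (Suc n) + ?s (Suc (Suc n)))"
      unfolding Z_eq using \<tau>pos
      by (subst integral_mult_right_zero, subst Bochner_Integration.integral_add[OF int_old I_err(1)[OF assms]])
        (auto simp: abs_mult divide_le_cancel)
  qed
  \<comment> \<open>On \<open>I c n\<close> both the error and x n - a are square-integrable, so
    their product is dominated by the sum of squares.\<close>
  have int_ez: "integrable M (\<lambda>w. norm (err n w) * norm (indicator H w *\<^sub>R (- 2 *\<^sub>R (x n w - a))))"
    if H: "H \<in> sets (F n)" "H \<subseteq> I c n" for H n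
  proof (rule Bochner_Integration.integrable_bound)
    show "integrable M (\<lambda>w. indicator (I c n) w * (norm (err n w))\<^sup>2 + indicator (I c n) w * (norm (x n w - a))\<^sup>2)"
      by (intro Bochner_Integration.integrable_add I_err(1) localized_square_integrable assms) simp
    have [measurable]: "H \<in> sets M" using H(1) subM by (auto simp: subalgebra_def)
    show "(\<lambda>w. norm (err n w) * norm (indicator H w *\<^sub>R (- 2 *\<^sub>R (x n w - a)))) \<in> borel_measurable M"
      by measurable
    show "AE w in M. norm (norm (err n w) * norm (indicator H w *\<^sub>R (- 2 *\<^sub>R (x n w - a))))
       \<le> norm (indicator (I c n) w * (norm (err n w))\<^sup>2 + indicator (I c n) w * (norm (x n w - a))\<^sup>2)"
    proof (rule AE_I2)
      fix w
      show "norm (norm (err n w) * norm (indicator H w *\<^sub>R (- 2 *\<^sub>R (x n w - a))))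
         \<le> norm (indicator (I c n) w * (norm (err n w))\<^sup>2 + indicator (I c n) w * (norm (x n w - a))\<^sup>2)"
        using H(2) two_mult_le_squares[of "norm (err n w)" "norm (x n w - a)"]
        by (auto simp: indicator_def)
    qed
  qed
  have z_meas: "(\<lambda>w. indicator H w *\<^sub>R (- 2 *\<^sub>R (x n w - a))) \<in> borel_measurable (F n)" if "H \<in> sets (F n)" for H n
    using that x_adapted[of n n] by measurable
  show "integrable M (\<lambda>w. indicator (I c (Suc (Suc n))) w * inner (err (Suc (Suc n)) w) (- 2 *\<^sub>R (x (Suc (Suc n)) w - a)))" for n
  proof (rule Bochner_Integration.integrable_bound)
    show "integrable M (\<lambda>w. norm (err (Suc (Suc n)) w) * norm (indicator (I c (Suc (Suc n))) w *\<^sub>R (- 2 *\<^sub>R (x (Suc (Suc n)) w - a))))"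
      by (rule int_ez[OF I_F]) simp
    show "(\<lambda>w. indicator (I c (Suc (Suc n))) w * inner (err (Suc (Suc n)) w) (- 2 *\<^sub>R (x (Suc (Suc n)) w - a))) \<in> borel_measurable M"
      by measurable
    show "AE w in M. norm (indicator (I c (Suc (Suc n))) w * inner (err (Suc (Suc n)) w) (- 2 *\<^sub>R (x (Suc (Suc n)) w - a)))
      \<le> norm (norm (err (Suc (Suc n)) w) * norm (indicator (I c (Suc (Suc n))) w *\<^sub>R (- 2 *\<^sub>R (x (Suc (Suc n)) w - a))))"
    proof (rule AE_I2)
      fix w
      have "norm (inner (err (Suc (Suc n)) w) (- 2 *\<^sub>R (x (Suc (Suc n)) w - a)))
        \<le> norm (err (Suc (Suc n)) w) * norm (- 2 *\<^sub>R (x (Suc (Suc n)) w - a))"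
        unfolding real_norm_def by (rule Cauchy_Schwarz_ineq2)
      then show "norm (indicator (I c (Suc (Suc n))) w * inner (err (Suc (Suc n)) w) (- 2 *\<^sub>R (x (Suc (Suc n)) w - a)))
        \<le> norm (norm (err (Suc (Suc n)) w) * norm (indicator (I c (Suc (Suc n))) w *\<^sub>R (- 2 *\<^sub>R (x (Suc (Suc n)) w - a))))"
        by (cases "w \<in> I c (Suc (Suc n))") (auto simp del: inner_scaleR_right)
    qed
  qed
  \<comment> \<open>The indicator of H is moved into the second factor, which stays measurable for
    the filtration, so orthogonality applies.\<close>
  show "(\<integral>w. indicator H w * inner (err (Suc (Suc n)) w) (- 2 *\<^sub>R (x (Suc (Suc n)) w - a)) \<partial>M) = 0"
    if "H \<in> sets (F (Suc (Suc n)))" "H \<subseteq> I c (Suc (Suc n))" for n H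
    using integral_inner_eq_zero[OF subM err_integrable z_meas[OF that(1)] err_mean_zero int_ez[OF that]] by (simp add: mult.assoc)
qed (rule V_descent)

lemma AE_convergence:
  "AE w in M. convergent (\<lambda>n. norm (x n w - a)) \<and> (\<lambda>n. x (Suc n) w - x n w) \<longlonglongrightarrow> 0"
proof -
  \<comment> \<open>Natural levels c suffice, so a countable union of null sets is
    discarded.\<close>
  have "AE w in M. \<forall>c::nat. (\<forall>n. w \<in> I (real c) (Suc (Suc n))) \<longrightarrow>
    convergent (\<lambda>n. V n w) \<and> summable (\<lambda>n. \<tau> / 2 * (norm (x (Suc (Suc (Suc n))) w - x (Suc (Suc n)) w))\<^sup>2)"
    unfolding AE_all_countable by (intro allI localized_convergence) simp
  with AE_I show ?thesis
  proof eventually_elim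
    case (elim w)
    then have V: "convergent (\<lambda>n. V n w)"
      and "summable (\<lambda>n. \<tau> / 2 * (norm (x (Suc (Suc (Suc n))) w - x (Suc (Suc n)) w))\<^sup>2)" by blast+
    then have "(\<lambda>n. 2 / \<tau> * (\<tau> / 2 * (norm (x (Suc (Suc (Suc n))) w - x (Suc (Suc n)) w))\<^sup>2)) \<longlonglongrightarrow> 2 / \<tau> * 0"
      by (intro tendsto_intros summable_LIMSEQ_zero)
    then have "(\<lambda>n. sqrt ((norm (x (Suc (Suc (Suc n))) w - x (Suc (Suc n)) w))\<^sup>2)) \<longlonglongrightarrow> sqrt 0"
      using \<tau>pos by (intro tendsto_intros) simp
    then have "(\<lambda>n. x (Suc (Suc (Suc n))) w - x (Suc (Suc n)) w) \<longlonglongrightarrow> 0"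
      by (simp add: tendsto_norm_zero_iff)
    then have d: "(\<lambda>n. x (Suc n) w - x n w) \<longlonglongrightarrow> 0"
      using filterlim_sequentially_Suc[of "\<lambda>n. x (Suc n) w - x n w"]
        filterlim_sequentially_Suc[of "\<lambda>n. x (Suc (Suc n)) w - x (Suc n) w"] by blast
    show ?case
      using norm_convergent_of_lyapunov[OF Blip \<mu>pos \<gamma>pos inverse_\<gamma>_ge \<gamma>mono V[unfolded V_def] d] d by blast
  qed
qed

end

section \<open>Weak cluster points and the random limit\<close>

lemma AE_err_tendsto: "AE w in M. (\<lambda>n. err n w) \<longlonglongrightarrow> 0"
proof -
  have "AE w in M. \<forall>c::nat. summable (\<lambda>n. indicator (I (real c) n) w * (norm (err n w))\<^sup>2)"
    unfolding AE_all_countable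
    by (intro allI AE_summable_of_summable_integral I_err) auto
  with AE_I show ?thesis
  proof eventually_elim
    case (elim w)
    then obtain c :: nat where c: "\<And>n. w \<in> I (real c) n" by blast
    from elim(2) have "summable (\<lambda>n. indicator (I (real c) n) w * (norm (err n w))\<^sup>2)" by blast
    then have "summable (\<lambda>n. (norm (err n w))\<^sup>2)" using c by simp
    then have "(\<lambda>n. sqrt ((norm (err n w))\<^sup>2)) \<longlonglongrightarrow> sqrt 0"
      by (intro tendsto_intros summable_LIMSEQ_zero)
    then show ?case by (simp add: tendsto_norm_zero_iff)
  qed
qed

text \<open>The residual at x (n+2) consists of an increment divided by a step size, an error, and B
  x - B y. The reciprocal steps are bounded by 1 / \<gamma> 0, and x - y is a difference of two
  increments, so all three parts vanish.\<close>

lemma weak_cluster_point_zer_sum: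
  assumes w: "w \<in> space M" and d: "(\<lambda>n. x (Suc n) w - x n w) \<longlonglongrightarrow> 0"
    and e: "(\<lambda>n. err n w) \<longlonglongrightarrow> 0" and bd: "\<And>n. norm (x n w) \<le> C"
    and k: "strict_mono k" and l: "\<And>v. (\<lambda>n. inner (x (k n) w) v) \<longlonglongrightarrow> inner l v"
  shows "l \<in> zer_sum A B"
proof -
  define u where "u n = (1 / \<gamma> n) *\<^sub>R (x n w - \<gamma> n *\<^sub>R (B (y n w) + err n w) - x (Suc n) w)" for n
  have d': "(\<lambda>n. x (Suc (Suc n)) w - x (Suc n) w) \<longlonglongrightarrow> 0"
    using filterlim_compose[OF d filterlim_Suc] by simp
  have u_eq: "u (Suc n) + B (x (Suc (Suc n)) w) = - ((1 / \<gamma> (Suc n)) *\<^sub>R (x (Suc (Suc n)) w - x (Suc n) w))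
      - err (Suc n) w + (B (x (Suc (Suc n)) w) - B (y (Suc n) w))" for n
    using \<gamma>pos[of "Suc n"] by (simp add: u_def algebra_simps)
  have g_bd: "1 / \<gamma> n \<le> 1 / \<gamma> 0" for n
    using \<gamma>mono \<gamma>pos by (intro divide_left_mono) (auto simp: monoD)
  have "(\<lambda>n. u (Suc n) + B (x (Suc (Suc n)) w)) \<longlonglongrightarrow> - 0 - 0 + 0"
    unfolding u_eq
  proof (intro tendsto_add tendsto_diff tendsto_minus)
    show "(\<lambda>n. (1 / \<gamma> (Suc n)) *\<^sub>R (x (Suc (Suc n)) w - x (Suc n) w)) \<longlonglongrightarrow> 0"
    proof (rule Lim_null_comparison)
      have "norm ((1 / \<gamma> (Suc n)) *\<^sub>R (x (Suc (Suc n)) w - x (Suc n) w)) \<le> 1 / \<gamma> 0 * norm (x (Suc (Suc n)) w - x (Suc n) w)" for n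
        using mult_right_mono[OF g_bd[of "Suc n"] norm_ge_zero[of "x (Suc (Suc n)) w - x (Suc n) w"]] \<gamma>pos[of "Suc n"]
        by simp
      then show "\<forall>\<^sub>F n in sequentially. norm ((1 / \<gamma> (Suc n)) *\<^sub>R (x (Suc (Suc n)) w - x (Suc n) w)) \<le> 1 / \<gamma> 0 * norm (x (Suc (Suc n)) w - x (Suc n) w)"
        by simp
      show "(\<lambda>n. 1 / \<gamma> 0 * norm (x (Suc (Suc n)) w - x (Suc n) w)) \<longlonglongrightarrow> 0"
        by (rule tendsto_mult_right_zero[OF tendsto_norm_zero[OF d']])
    qed
    show "(\<lambda>n. err (Suc n) w) \<longlonglongrightarrow> 0"
      using filterlim_compose[OF e filterlim_Suc] by simp
    show "(\<lambda>n. B (x (Suc (Suc n)) w) - B (y (Suc n) w)) \<longlonglongrightarrow> 0"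
    proof (rule Lim_null_comparison)
      have "norm (B (x (Suc (Suc n)) w) - B (y (Suc n) w))
        \<le> \<mu> * norm ((x (Suc (Suc n)) w - x (Suc n) w) - (x (Suc n) w - x n w))" for n
        using lipschitz_onD[OF Blip, of "x (Suc (Suc n)) w" "y (Suc n) w"]
        by (simp add: dist_norm y_Suc scaleR_2 algebra_simps)
      then show "\<forall>\<^sub>F n in sequentially. norm (B (x (Suc (Suc n)) w) - B (y (Suc n) w))
        \<le> \<mu> * norm ((x (Suc (Suc n)) w - x (Suc n) w) - (x (Suc n) w - x n w))" by simp
      show "(\<lambda>n. \<mu> * norm ((x (Suc (Suc n)) w - x (Suc n) w) - (x (Suc n) w - x n w))) \<longlonglongrightarrow> 0"
        using tendsto_mult_right_zero[OF tendsto_norm_zero[OF tendsto_diff[OF d' d, simplified]]] by simp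
    qed
  qed
  then have q: "(\<lambda>n. u (Suc n) + B (x (Suc (Suc n)) w)) \<longlonglongrightarrow> 0" by simp
  \<comment> \<open>The residual exists from index 2 on. Strict monotonicity gives k (n+2) \<ge>
    n+2, so the truncated subtraction is exact.\<close>
  define k' where "k' n = k (Suc (Suc n)) - 2" for n
  have k2: "k (Suc (Suc n)) = Suc (Suc (k' n))" for n
    using seq_suble[OF k, of "Suc (Suc n)"] by (simp add: k'_def)
  have "strict_mono k'"
  proof (rule strict_monoI)
    fix m n :: nat assume "m < n"
    then have "k (Suc (Suc m)) < k (Suc (Suc n))" using k by (simp add: strict_mono_less)
    then show "k' m < k' n" unfolding k2 by simp
  qed
  show ?thesis
  proof (rule weak_cluster_zer_sum[OF A Bmono \<mu>pos Blip])
    show "u (Suc (k' n)) \<in> A (x (Suc (Suc (k' n))) w)" for n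
      unfolding u_def by (rule step_mem[OF w])
    show "(\<lambda>n. u (Suc (k' n)) + B (x (Suc (Suc (k' n))) w)) \<longlonglongrightarrow> 0"
      using LIMSEQ_subseq_LIMSEQ[OF q \<open>strict_mono k'\<close>] by (simp add: o_def)
    show "norm (x (Suc (Suc (k' n))) w) \<le> C" for n by (rule bd)
    show "(\<lambda>n. inner (x (Suc (Suc (k' n))) w) v) \<longlonglongrightarrow> inner l v" for v
      unfolding k2[symmetric]
      using filterlim_compose[OF filterlim_compose[OF l[of v] filterlim_Suc] filterlim_Suc] by simp
  qed
qed

theorem AE_weak_limit:
  assumes "zer_sum A B \<noteq> {}"
  shows "AE w in M. \<exists>l\<in>zer_sum A B. \<forall>v. (\<lambda>n. inner (x n w) v) \<longlonglongrightarrow> inner l v"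
proof -
  obtain D where D: "countable D" "D \<subseteq> zer_sum A B" "zer_sum A B \<subseteq> closure D"
    using ex_countable_dense_subset by blast
  have "D \<noteq> {}" using D(3) assms by auto
  then obtain d where "d \<in> D" by blast
  have zer: "- B a \<in> A a" if "a \<in> D" for a
  proof -
    obtain u where "u \<in> A a" "u + B a = 0" using \<open>a \<in> D\<close> D(2) by (auto simp: zer_sum_def)
    then show ?thesis by (simp add: eq_neg_iff_add_eq_0[symmetric])
  qed
  have "AE w in M. \<forall>a\<in>D. convergent (\<lambda>n. norm (x n w - a)) \<and> (\<lambda>n. x (Suc n) w - x n w) \<longlonglongrightarrow> 0"
    using AE_convergence[OF zer] D(1) by (intro AE_ball_countable') auto
  with AE_err_tendsto AE_space show ?thesis
  proof eventually_elim
    case (elim w)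
    have "Bseq (\<lambda>n. norm (x n w - d))"
      using elim(3) \<open>d \<in> D\<close> by (blast intro: convergent_imp_Bseq)
    then obtain K where K: "\<And>n. norm (norm (x n w - d)) \<le> K"
      unfolding Bseq_def by blast
    have bd: "norm (x n w) \<le> K + norm d" for n
      using K[of n] norm_triangle_sub[of "x n w" d] by simp
    show ?case
    proof (rule opial[OF D(3) \<open>D \<noteq> {}\<close>])
      show "convergent (\<lambda>n. norm (x n w - z))" if "z \<in> D" for z using elim(3) that by blast
      show "l \<in> zer_sum A B" if "strict_mono k" "\<And>v. (\<lambda>n. inner (x (k n) w) v) \<longlonglongrightarrow> inner l v" for k l
        using weak_cluster_point_zer_sum[OF elim(2) _ elim(1) bd that] elim(3) \<open>d \<in> D\<close> by blast
    qed
  qed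
qed

end

text \<open>The set where convergence fails need not be measurable. It is enlarged to a measurable
  null set \<open>N\<close>, on which the limit is set to z; the result is \<open>Z\<close>-valued
  everywhere and its inner products are limits of measurable functions.\<close>

lemma weak_limit_random_variable:
  fixes x :: "nat \<Rightarrow> 'w \<Rightarrow> 'a::{real_inner, second_countable_topology}"
  assumes x: "\<And>n. x n \<in> borel_measurable M" and "z \<in> Z"
    and lim: "AE w in M. \<exists>l\<in>Z. \<forall>v. (\<lambda>n. inner (x n w) v) \<longlonglongrightarrow> inner l v"
  shows "\<exists>xbar. xbar \<in> borel_measurable M \<and> (\<forall>w \<in> space M. xbar w \<in> Z) \<and>
           (AE w in M. \<forall>v. (\<lambda>n. inner (x n w) v) \<longlonglongrightarrow> inner (xbar w) v)"
proof -
  obtain N where N: "N \<in> null_sets M"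
    "{w \<in> space M. \<not> (\<exists>l\<in>Z. \<forall>v. (\<lambda>n. inner (x n w) v) \<longlonglongrightarrow> inner l v)} \<subseteq> N"
    using lim unfolding eventually_ae_filter by blast
  have [measurable]: "N \<in> sets M" using N(1) by auto
  have "\<exists>l. l \<in> Z \<and> (w \<in> space M \<longrightarrow> w \<notin> N \<longrightarrow> (\<forall>v. (\<lambda>n. inner (x n w) v) \<longlonglongrightarrow> inner l v))
      \<and> (w \<in> N \<longrightarrow> l = z)" for w
    using N(2) \<open>z \<in> Z\<close> by (cases "w \<in> N"; cases "w \<in> space M") blast+
  then obtain xbar where xbar: "\<And>w. xbar w \<in> Z" "\<And>w. w \<in> N \<Longrightarrow> xbar w = z"
    and conv: "\<And>w v. w \<in> space M \<Longrightarrow> w \<notin> N \<Longrightarrow> (\<lambda>n. inner (x n w) v) \<longlonglongrightarrow> inner (xbar w) v"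
    by metis
  have "xbar \<in> borel_measurable M"
  proof (rule borel_measurable_weakly)
    fix v
    show "(\<lambda>w. inner (xbar w) v) \<in> borel_measurable M"
    proof (rule borel_measurable_LIMSEQ_real)
      show "(\<lambda>n. if w \<in> N then inner z v else inner (x n w) v) \<longlonglongrightarrow> inner (xbar w) v" if "w \<in> space M" for w
        using conv[OF that] xbar(2)[of w] by (cases "w \<in> N") auto
      show "(\<lambda>w. if w \<in> N then inner z v else inner (x n w) v) \<in> borel_measurable M" for n
        using x[of n] by measurable
    qed
  qed
  moreover have "AE w in M. \<forall>v. (\<lambda>n. inner (x n w) v) \<longlonglongrightarrow> inner (xbar w) v"
    using AE_not_in[OF N(1)] AE_space by eventually_elim (use conv in blast)
  ultimately show ?thesis using xbar(1) by blast
qed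

theorem mainTheorem4:
  fixes M :: "'w measure"
    and A :: "'a::{real_inner, banach, second_countable_topology} \<Rightarrow> 'a set"
    and B :: "'a \<Rightarrow> 'a"
    and \<mu> :: real
    and \<gamma> :: "nat \<Rightarrow> real" and \<gamma>m1 :: real
    and x :: "nat \<Rightarrow> 'w \<Rightarrow> 'a" and xm1 :: "'w \<Rightarrow> 'a"
    and r :: "nat \<Rightarrow> 'w \<Rightarrow> 'a"
  defines "xx \<equiv> (\<lambda>n. if n = 0 then xm1 else x (n - 1))"
  defines "y \<equiv> (\<lambda>n w. 2 *\<^sub>R x n w - xx n w)"
  defines "F \<equiv> nat_filtration M x"
  assumes M: "prob_space M"
    and A: "maximally_monotone A"
    and Bmono: "monotone_fun B" and \<mu>pos: "\<mu> > 0" and Blip: "\<mu>-lipschitz_on UNIV B"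
    and zer: "zer_sum A B \<noteq> {}"
    and \<gamma>range: "\<gamma>m1 \<in> {0<..<(sqrt 2 - 1) / \<mu>}" "\<And>n. \<gamma> n \<in> {0<..<(sqrt 2 - 1) / \<mu>}"
    and \<gamma>mono: "\<gamma>m1 \<le> \<gamma> 0" "mono \<gamma>"
    and \<tau>: "(INF n. 2 / \<gamma> n - 1 / (if n = 0 then \<gamma>m1 else \<gamma> (n - 1)) - \<mu> * (1 + sqrt 2)) > 0"
    and x0: "x 0 \<in> borel_measurable M" "integrable M (\<lambda>w. (norm (x 0 w))\<^sup>2)"
    and xm1: "xm1 \<in> borel_measurable M" "integrable M (\<lambda>w. (norm (xm1 w))\<^sup>2)"
    and r_meas: "\<And>n. r n \<in> borel_measurable M"
    and r_ce: "\<And>n. is_cond_exp M (F n) (r n) (\<lambda>w. B (y n w))"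
    and iter: "\<And>n w. w \<in> space M \<Longrightarrow>
                 x (Suc n) w = resolvent (\<gamma> n) A (x n w - \<gamma> n *\<^sub>R r n w)"
    and noise: "AE w in M. (\<Sum>n. nn_cond_exp M (F n)
                   (\<lambda>w. ennreal ((norm (r n w - B (y n w)))\<^sup>2)) w) < \<infinity>"
  shows "\<exists>xbar. xbar \<in> borel_measurable M \<and> (\<forall>w \<in> space M. xbar w \<in> zer_sum A B) \<and>
           (AE w in M. \<forall>v. (\<lambda>n. inner (x n w) v) \<longlonglongrightarrow> inner (xbar w) v)"
proof -
  define \<tau> where "\<tau> = (INF n. 2 / \<gamma> n - 1 / (if n = 0 then \<gamma>m1 else \<gamma> (n - 1)) - \<mu> * (1 + sqrt 2))"
  \<comment> \<open>A real infimum bounds its terms only for a range bounded below; here every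
    earlier step is at least \<open>\<gamma>m1\<close>.\<close>
  have bdd: "bdd_below (range (\<lambda>n. 2 / \<gamma> n - 1 / (if n = 0 then \<gamma>m1 else \<gamma> (n - 1)) - \<mu> * (1 + sqrt 2)))"
  proof (rule bdd_belowI2)
    fix n :: nat
    have "\<gamma>m1 \<le> (if n = 0 then \<gamma>m1 else \<gamma> (n - 1))"
      using \<gamma>mono(1) monoD[OF \<gamma>mono(2), of 0 "n - 1"] by auto
    then have "1 / (if n = 0 then \<gamma>m1 else \<gamma> (n - 1)) \<le> 1 / \<gamma>m1"
      using \<gamma>range(1) by (intro divide_left_mono) auto
    moreover have "0 \<le> 2 / \<gamma> n" using \<gamma>range(2)[of n] by simp
    ultimately show "- (1 / \<gamma>m1) - \<mu> * (1 + sqrt 2)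
      \<le> 2 / \<gamma> n - 1 / (if n = 0 then \<gamma>m1 else \<gamma> (n - 1)) - \<mu> * (1 + sqrt 2)" by linarith
  qed
  have "\<tau> \<le> 2 / \<gamma> (Suc n) - 1 / \<gamma> n - \<mu> * (1 + sqrt 2)" for n
    using cINF_lower[OF bdd UNIV_I, of "Suc n"] by (simp add: \<tau>_def)
  moreover have "y 0 w = 2 *\<^sub>R x 0 w - xm1 w" "y (Suc n) w = 2 *\<^sub>R x (Suc n) w - x n w" for n w
    by (simp_all add: y_def xx_def)
  ultimately interpret reflected_stochastic_fb M A B \<mu> \<tau> \<gamma> x xm1 r y
    using assms(4-) unfolding F_def
    by (intro reflected_stochastic_fb.intro reflected_stochastic_fb_axioms.intro) (auto simp: \<tau>_def)
  obtain z where "z \<in> zer_sum A B" using zer by blast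
  then show ?thesis
    by (rule weak_limit_random_variable[OF x_meas _ AE_weak_limit[OF zer]])
qed

end
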